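(* Assume that $\mathfrak{b}=\mathfrak{d}$. Then the following hold. (1) Let $X$ be a space such that for every ultrafilter $U$ and every hereditarily Lindel\"of $U$-Menger space $T$ the product space $X\times T$ is Menger. Then $X$ is productively Hurewicz in the class of hereditarily Lindel\"of spaces. (2) Each space that is productively Scheepers in the class of hereditarily Lindel\"of spaces is productively Hurewicz in the class of hereditarily Lindel\"of spaces. (3) Each space that is, for all ultrafilters $U$, productively $U$-Menger in the class of hereditarily Lindel\"of spaces is productively Hurewicz in the class of hereditarily Lindel\"of spaces.
   Context: A space is an infinite Tychonoff topological space. An ultrafilter means a free ultrafilter on $\omega$. $\mathfrak{b}$ and $\mathfrak{d}$ are the usual bounding and dominating numbers (the minimal cardinality of an unbounded, respectively dominating, family in $\omega^\omega$ with respect to eventual domination). A space $X$ is Menger (respectively Scheepers, Hurewicz, $U$-Menger for an ultrafilter $U$) if for every sequence $\mathcal{U}_0,\mathcal{U}_1,\dots$ of open covers of $X$ there are finite sets $\mathcal{F}_0\subseteq\mathcal{U}_0,\mathcal{F}_1\subseteq\mathcal{U}_1,\dots$ such that, respectively: Menger: the family $\{\bigcup\mathcal{F}_n : n\in\omega\}$ covers $X$; Scheepers: for every finite $F\subseteq X$ there is $n$ with $F\subseteq\bigcup\mathcal{F}_n$; Hurewicz: for every $x\in X$, $x\in\bigcup\mathcal{F}_n$ for all but finitely many $n$; $U$-Menger: for every $x\in X$, $\{n : x\in\bigcup\mathcal{F}_n\}\in U$. For a topological property $\mathbf{P}$, a space $X$ is productively $\mathbf{P}$ in a given class of spaces if for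 every space $Y$ from this class with the property $\mathbf{P}$, the product space $X\times Y$ has the property $\mathbf{P}$. *)

theory Defs
  imports "HOL-Analysis.Analysis"
begin

unbundle cardinal_syntax

section \<open>The cardinals b and d\<close>

definition eventually_dominated :: "(nat \<Rightarrow> nat) \<Rightarrow> (nat \<Rightarrow> nat) \<Rightarrow> bool" (infix "\<le>\<^sup>*" 50)
  where "f \<le>\<^sup>* g \<longleftrightarrow> (\<forall>\<^sub>F n in sequentially. f n \<le> g n)"

definition unbounded_family :: "(nat \<Rightarrow> nat) set \<Rightarrow> bool"
  where "unbounded_family B \<longleftrightarrow> \<not> (\<exists>g. \<forall>f\<in>B. f \<le>\<^sup>* g)"

definition dominating_family :: "(nat \<Rightarrow> nat) set \<Rightarrow> bool"
  where "dominating_family D \<longleftrightarrow> (\<forall>f. \<exists>g\<in>D. f \<le>\<^sup>* g)"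

text \<open>
  Cardinals are represented by well-orders, as in the library; they are to be compared by
  \<open>=o\<close> and \<open>\<le>o\<close>, since the chosen representative depends on the choice of \<open>A\<close>.
\<close>

definition min_cardinality :: "'a set set \<Rightarrow> 'a rel"
  where "min_cardinality \<A> = (SOME r. \<exists>A\<in>\<A>. r = |A| \<and> (\<forall>B\<in>\<A>. |A| \<le>o |B| ))"

lemma min_cardinality:
  assumes "\<A> \<noteq> {}"
  shows "\<exists>A\<in>\<A>. min_cardinality \<A> = |A| \<and> (\<forall>B\<in>\<A>. |A| \<le>o |B| )"
proof -
  obtain r where r: "r \<in> card_of ` \<A>" "\<And>s. s <o r \<Longrightarrow> s \<notin> card_of ` \<A>"
    using wfE_min[OF wf_ordLess, of _ "card_of ` \<A>"] assms by (metis equals0I image_is_empty)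
  then obtain A where A: "A \<in> \<A>" "r = |A|"
    by auto
  have "|A| \<le>o |B|" if "B \<in> \<A>" for B
    using r A that by (metis card_of_Well_order imageI not_ordLess_iff_ordLeq)
  then have "\<exists>r. \<exists>A\<in>\<A>. r = |A| \<and> (\<forall>B\<in>\<A>. |A| \<le>o |B| )"
    using A by blast
  then show ?thesis
    unfolding min_cardinality_def by (rule someI2_ex) blast
qed

definition bounding_number :: "(nat \<Rightarrow> nat) rel" (\<open>\<bb>\<close>)
  where "\<bb> = min_cardinality {B. unbounded_family B}"

definition dominating_number :: "(nat \<Rightarrow> nat) rel" (\<open>\<dd>\<close>)
  where "\<dd> = min_cardinality {D. dominating_family D}"

section \<open>Free ultrafilters\<close>

text \<open>
  The members of the ultrafilter \<open>U\<close> are the sets \<open>{n. P n}\<close> such that \<open>eventually P U\<close>.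
\<close>

definition free_ultrafilter :: "nat filter \<Rightarrow> bool"
  where "free_ultrafilter U \<longleftrightarrow>
    U \<noteq> bot \<and>
    (\<forall>P. eventually P U \<or> eventually (\<lambda>n. \<not> P n) U) \<and>
    (\<forall>P. eventually P U \<longrightarrow> infinite {n. P n})"

section \<open>Spaces and covering properties\<close>

definition infinite_Tychonoff_space :: "'a topology \<Rightarrow> bool"
  where "infinite_Tychonoff_space X \<longleftrightarrow>
    infinite (topspace X) \<and> completely_regular_space X \<and> Hausdorff_space X"

definition hereditarily_Lindelof_Tychonoff :: "'a topology \<Rightarrow> bool"
  where "hereditarily_Lindelof_Tychonoff X \<longleftrightarrow>
    infinite_Tychonoff_space X \<and> hereditarily Lindelof_space X"

definition open_cover :: "'a topology \<Rightarrow> 'a set set \<Rightarrow> bool"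
  where "open_cover X \<U> \<longleftrightarrow> (\<forall>U\<in>\<U>. openin X U) \<and> \<Union>\<U> = topspace X"

definition Menger_space :: "'a topology \<Rightarrow> bool"
  where "Menger_space X \<longleftrightarrow>
    (\<forall>\<U> :: nat \<Rightarrow> 'a set set. (\<forall>n. open_cover X (\<U> n)) \<longrightarrow>
      (\<exists>\<F>. (\<forall>n. finite (\<F> n) \<and> \<F> n \<subseteq> \<U> n) \<and>
           (\<Union>n. \<Union>(\<F> n)) = topspace X))"

definition Scheepers_space :: "'a topology \<Rightarrow> bool"
  where "Scheepers_space X \<longleftrightarrow>
    (\<forall>\<U> :: nat \<Rightarrow> 'a set set. (\<forall>n. open_cover X (\<U> n)) \<longrightarrow>
      (\<exists>\<F>. (\<forall>n. finite (\<F> n) \<and> \<F> n \<subseteq> \<U> n) \<and>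
           (\<forall>F. finite F \<and> F \<subseteq> topspace X \<longrightarrow> (\<exists>n. F \<subseteq> \<Union>(\<F> n)))))"

definition Hurewicz_space :: "'a topology \<Rightarrow> bool"
  where "Hurewicz_space X \<longleftrightarrow>
    (\<forall>\<U> :: nat \<Rightarrow> 'a set set. (\<forall>n. open_cover X (\<U> n)) \<longrightarrow>
      (\<exists>\<F>. (\<forall>n. finite (\<F> n) \<and> \<F> n \<subseteq> \<U> n) \<and>
           (\<forall>x\<in>topspace X. \<forall>\<^sub>F n in sequentially. x \<in> \<Union>(\<F> n))))"

definition ultrafilter_Menger_space :: "nat filter \<Rightarrow> 'a topology \<Rightarrow> bool"
  where "ultrafilter_Menger_space U X \<longleftrightarrow>
    (\<forall>\<U> :: nat \<Rightarrow> 'a set set. (\<forall>n. open_cover X (\<U> n)) \<longrightarrow>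
      (\<exists>\<F>. (\<forall>n. finite (\<F> n) \<and> \<F> n \<subseteq> \<U> n) \<and>
           (\<forall>x\<in>topspace X. \<forall>\<^sub>F n in U. x \<in> \<Union>(\<F> n))))"

section \<open>Productivity\<close>

text \<open>
  \<open>C\<close> is the class of spaces from which the second factor \<open>Y\<close> is taken; its type fixes the type
  \<open>'b\<close> that contains the points of \<open>Y\<close>. There is one definition for each property because a
  property cannot be passed as an argument and used both at \<open>'b\<close> and at \<open>'a \<times> 'b\<close>.

  A class of hereditarily Lindelof spaces can be taken over the single type \<open>real\<close> without loss: a
  hereditarily Lindelof Hausdorff space has at most continuum many points (de Groot), so it is
  homeomorphic to a topology carried by some set of reals. The carrier \<open>topspace Y\<close> is an
  arbitrary subset of \<open>'b\<close>, and the topology is unrelated to the standard one of \<open>real\<close>.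
\<close>

definition productively_Scheepers_in :: "('b topology \<Rightarrow> bool) \<Rightarrow> 'a topology \<Rightarrow> bool"
  where "productively_Scheepers_in C X \<longleftrightarrow>
    (\<forall>Y. C Y \<and> Scheepers_space Y \<longrightarrow> Scheepers_space (prod_topology X Y))"

definition productively_Hurewicz_in :: "('b topology \<Rightarrow> bool) \<Rightarrow> 'a topology \<Rightarrow> bool"
  where "productively_Hurewicz_in C X \<longleftrightarrow>
    (\<forall>Y. C Y \<and> Hurewicz_space Y \<longrightarrow> Hurewicz_space (prod_topology X Y))"

definition productively_ultrafilter_Menger_in ::
    "nat filter \<Rightarrow> ('b topology \<Rightarrow> bool) \<Rightarrow> 'a topology \<Rightarrow> bool"
  where "productively_ultrafilter_Menger_in U C X \<longleftrightarrow>
    (\<forall>Y. C Y \<and> ultrafilter_Menger_space U Y \<longrightarrow> ultrafilter_Menger_space U (prod_topology X Y))"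

end

theory Submission
  imports Defs
begin

text \<open>
  Suppose that \<open>Y\<close> is Hurewicz but \<open>X \<times> Y\<close> is not. Covers of the (Lindelof) product give monotone
  functions \<open>s z\<close>, \<open>z \<in> X \<times> Y\<close>, which form an unbounded family. Fix a scale \<open>p i\<close> of length
  \<open>\<bb> = \<dd>\<close>. By recursion along the scale one picks \<open>z i = (x i, y i)\<close> such that the sets
  \<open>{m. p i (p i m) \<le> s (z i) m}\<close> are centered, hence lie in one ultrafilter \<open>U\<close>; this is possible
  because fewer than \<open>\<bb>\<close> infinite sets have their gaps bounded by one function, and monotonicity
  spreads a large value of \<open>s z\<close> over such a gap. The sets
  \<open>b i = {n. p i n \<le> s (z i) n}\<close> then contain the intervals from \<open>m\<close> to \<open>p i m\<close> for \<open>U\<close>-many \<open>m\<close>.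

  Let \<open>T \<subseteq> Y \<times> P(\<omega>)\<close> consist of the points \<open>(y i, b i)\<close> and of all \<open>(y, c)\<close> with \<open>c\<close> cofinite.
  The long intervals in \<open>b i\<close> make \<open>T\<close> a \<open>U\<close>-Menger space. On \<open>X \<times> T\<close> the function that sends
  \<open>n\<close> to the value of \<open>s (x, y)\<close> at the first element of \<open>c\<close> after \<open>n\<close> is finite and semicontinuous
  in \<open>(x, y, c)\<close>, and at \<open>(x i, y i, b i)\<close> it dominates \<open>p i\<close>; so \<open>X \<times> T\<close> is not Menger.
\<close>

section \<open>Families of fewer than \<open>\<bb>\<close> functions, scales and ultrafilters\<close>

lemma bounded_if_less_bounding_number:
  fixes F :: "'i \<Rightarrow> nat \<Rightarrow> nat"
  assumes "|I| <o \<bb>"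
  shows "\<exists>g. \<forall>i\<in>I. F i \<le>\<^sup>* g"
proof -
  \<comment> \<open>\<open>min_cardinality\<close> denotes a minimum only over a nonempty class. The
    set of all functions is an unbounded family, because the successor of \<open>g\<close> escapes
    \<open>g\<close>.\<close>
  have "\<not> (\<lambda>n. Suc (g n)) \<le>\<^sup>* g" for g
    by (simp add: eventually_dominated_def)
  then have "unbounded_family (UNIV :: (nat \<Rightarrow> nat) set)"
    unfolding unbounded_family_def by blast
  then have "{B. unbounded_family B} \<noteq> {}" by blast
  from min_cardinality[OF this] have min: "\<bb> \<le>o |B|" if "unbounded_family B" for B
    using that unfolding bounding_number_def by auto
  have "|F ` I| <o \<bb>"
    using card_of_image assms by (rule ordLeq_ordLess_trans)
  then have "\<not> unbounded_family (F ` I)"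
    using min not_ordLess_ordLeq by blast
  then show ?thesis
    unfolding unbounded_family_def by blast
qed

text \<open>Induction on the size: a set of size n + 1 arises from one of size n by inserting a
  point. An infinite cardinal absorbs the resulting union, and also the final union over all
  sizes.\<close>

lemma finite_subsets_card_le:
  assumes "infinite I"
  shows "|{K. K \<subseteq> I \<and> finite K}| \<le>o |I|"
proof -
  have 1: "|{K. K \<subseteq> I \<and> finite K \<and> card K = n}| \<le>o |I|" for n
  proof (induction n)
    case 0
    have "{K. K \<subseteq> I \<and> finite K \<and> card K = 0} = {{}}" by auto
    moreover have "|{{} :: 'a set}| \<le>o |I|"
      using assms by (simp add: card_of_singl_ordLeq infinite_imp_nonempty)
    ultimately show ?case by simp
  next
    case (Suc n)
    let ?S = "{K. K \<subseteq> I \<and> finite K \<and> card K = n}"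
    have "|\<Union>K\<in>?S. (\<lambda>x. insert x K) ` I| \<le>o |I|"
      using assms Suc by (intro card_of_UNION_ordLeq_infinite) (auto intro: card_of_image)
    moreover have "{K. K \<subseteq> I \<and> finite K \<and> card K = Suc n} \<subseteq> (\<Union>K\<in>?S. (\<lambda>x. insert x K) ` I)"
    proof
      fix K assume K: "K \<in> {K. K \<subseteq> I \<and> finite K \<and> card K = Suc n}"
      then obtain x where "x \<in> K"
        by fastforce
      with K have "K - {x} \<in> ?S" "x \<in> I" "K = insert x (K - {x})" by auto
      then show "K \<in> (\<Union>K\<in>?S. (\<lambda>x. insert x K) ` I)" by blast
    qed
    ultimately show ?case
      using card_of_mono1 ordLeq_transitive by blast
  qed
  have "|\<Union>n\<in>(UNIV :: nat set). {K. K \<subseteq> I \<and> finite K \<and> card K = n}| \<le>o |I|"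
    using assms 1 by (intro card_of_UNION_ordLeq_infinite)
      (auto simp: infinite_iff_card_of_nat)
  moreover have "(\<Union>n\<in>(UNIV :: nat set). {K. K \<subseteq> I \<and> finite K \<and> card K = n}) = {K. K \<subseteq> I \<and> finite K}"
    by blast
  ultimately show ?thesis by (simp only:)
qed

text \<open>In the recursion along the scale each finite set of earlier indices contributes a
  function, and all of them must be bounded at once. A finite \<open>I\<close> is treated apart,
  since it has more finite subsets than elements; there a finite sum is a bound.\<close>

lemma bounded_on_finite_subsets:
  fixes F :: "'i set \<Rightarrow> nat \<Rightarrow> nat"
  assumes "|I| <o \<bb>"
  shows "\<exists>g. \<forall>K. K \<subseteq> I \<and> finite K \<longrightarrow> F K \<le>\<^sup>* g"
proof (cases "finite I")
  case True
  then have "F K n \<le> (\<Sum>K\<in>Pow I. F K n)" if "K \<subseteq> I" for K n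
    using that by (intro member_le_sum) auto
  then have "\<forall>K. K \<subseteq> I \<and> finite K \<longrightarrow> F K \<le>\<^sup>* (\<lambda>n. \<Sum>K\<in>Pow I. F K n)"
    by (auto simp: eventually_dominated_def)
  then show ?thesis by (intro exI[of _ "\<lambda>n. \<Sum>K\<in>Pow I. F K n"])
next
  case False
  then have "|{K. K \<subseteq> I \<and> finite K}| <o \<bb>"
    using finite_subsets_card_le assms ordLeq_ordLess_trans by blast
  from bounded_if_less_bounding_number[OF this] show ?thesis by blast
qed

lemma eventually_dominated_trans: "f \<le>\<^sup>* g \<Longrightarrow> g \<le>\<^sup>* h \<Longrightarrow> f \<le>\<^sup>* h"
  unfolding eventually_dominated_def by (erule (1) eventually_elim2) (rule order_trans)

lemma strict_mono_above:
  fixes f :: "nat \<Rightarrow> nat"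
  shows "\<exists>g. strict_mono g \<and> (\<forall>n. f n \<le> g n)"
proof -
  define g where "g n = (\<Sum>k\<le>n. Suc (f k))" for n
  have "strict_mono g"
    unfolding strict_mono_Suc_iff g_def by simp
  moreover have "f n \<le> g n" for n
    unfolding g_def by (cases n) auto
  ultimately show ?thesis by blast
qed

text \<open>A dominating family \<open>D\<close> of minimal cardinality is well-ordered in the type
  of its cardinal and serves as its own index set. Since \<open>p i\<close> bounds every member of
  \<open>D\<close> up to \<open>i\<close>, a function dominated by the member \<open>j\<close> is
  dominated by \<open>p i\<close> for all \<open>i\<close> from \<open>j\<close> on.\<close>

lemma exists_scale:
  assumes "\<bb> =o \<dd>"
  obtains r :: "(nat \<Rightarrow> nat) rel" and p
  where "Well_order r"
    and "\<And>i. i \<in> Field r \<Longrightarrow> |underS r i| <o \<bb>"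
    and "\<And>i. i \<in> Field r \<Longrightarrow> strict_mono (p i :: nat \<Rightarrow> nat)"
    and "\<And>g. \<exists>j\<in>Field r. \<forall>i. (j, i) \<in> r \<longrightarrow> g \<le>\<^sup>* p i"
proof -
  have "dominating_family UNIV"
    unfolding dominating_family_def eventually_dominated_def by (auto intro: always_eventually)
  then have "{D. dominating_family D} \<noteq> {}" by blast
  from min_cardinality[OF this] obtain D where D: "dominating_family D" "\<dd> = |D|"
    unfolding dominating_number_def by auto
  let ?r = "|D|"
  have field: "Field ?r = D" by (rule Field_card_of)
  have "|underS ?r i| <o ?r" if "i \<in> D" for i
    using that by (intro card_of_underS card_of_Card_order) (simp add: field)
  \<comment> \<open>Here \<open>\<bb> =o \<dd>\<close> enters: proper initial segments have fewer
    than \<dd> elements, hence fewer than \<bb>.\<close>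
  then have small: "|underS ?r i| <o \<bb>" if "i \<in> D" for i
    using that assms D by (metis ordIso_symmetric ordLess_ordIso_trans)
  have "\<exists>q. strict_mono q \<and> (\<forall>j\<in>insert i (underS ?r i). j \<le>\<^sup>* q)" if i: "i \<in> D" for i
  proof -
    from bounded_if_less_bounding_number[OF small[OF i], of "\<lambda>j. j"]
    obtain g where g: "\<forall>j\<in>underS ?r i. j \<le>\<^sup>* g" by blast
    obtain q where q: "strict_mono q" "\<forall>n. max (g n) (i n) \<le> q n"
      using strict_mono_above[of "\<lambda>n. max (g n) (i n)"] by blast
    have "g \<le>\<^sup>* q" "i \<le>\<^sup>* q" using q(2) by (auto simp: eventually_dominated_def)
    with g have "\<forall>j\<in>insert i (underS ?r i). j \<le>\<^sup>* q"
      using eventually_dominated_trans by blast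
    with q(1) show ?thesis by blast
  qed
  then obtain p where p: "\<And>i. i \<in> D \<Longrightarrow> strict_mono (p i)"
    "\<And>i j. i \<in> D \<Longrightarrow> j \<in> insert i (underS ?r i) \<Longrightarrow> j \<le>\<^sup>* p i"
    by metis
  have "\<exists>j\<in>Field ?r. \<forall>i. (j, i) \<in> ?r \<longrightarrow> g \<le>\<^sup>* p i" for g
  proof -
    obtain j where j: "j \<in> D" "g \<le>\<^sup>* j"
      using D(1) unfolding dominating_family_def by blast
    have "g \<le>\<^sup>* p i" if "(j, i) \<in> ?r" for i
    proof -
      have "i \<in> D" using that field FieldI2 by metis
      moreover have "j \<in> insert i (underS ?r i)" using that by (auto simp: underS_def)
      ultimately show ?thesis using p(2) j(2) eventually_dominated_trans by blast
    qed
    with j field show ?thesis by blast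
  qed
  moreover have "Well_order ?r" by (rule card_of_Well_order)
  ultimately show ?thesis
    using that[of ?r p] small p(1) field by simp
qed

section \<open>Free ultrafilters from filters and centered families\<close>

text \<open>Zorn's lemma gives a minimal nontrivial filter below \<open>F\<close>. It decides every
  \<open>P\<close>, because its restriction to \<open>P\<close> is either trivial or the filter
  itself. Its members are infinite because it contains the cofinite sets.\<close>

lemma exists_free_ultrafilter_le:
  fixes F :: "nat filter"
  assumes "F \<noteq> bot" "F \<le> sequentially"
  obtains U where "free_ultrafilter U" "U \<le> F"
proof -
  let ?A = "{G. G \<noteq> bot \<and> G \<le> F}"
  have "\<exists>U\<in>?A. \<forall>G\<in>?A. G \<le> U \<longrightarrow> G = U"
  proof (rule predicate_Zorn)
    show "partial_order_on ?A (relation_of (\<lambda>G H. H \<le> G) ?A)"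
      by (rule partial_order_on_relation_ofI) auto
  next
    fix C assume C: "C \<in> Chains (relation_of (\<lambda>G H. H \<le> G) ?A)"
    show "\<exists>u\<in>?A. \<forall>a\<in>C. u \<le> a"
    proof (cases "C = {}")
      case True
      with assms show ?thesis by auto
    next
      case False
      have sub: "C \<subseteq> ?A" and tot: "\<And>G H. G \<in> C \<Longrightarrow> H \<in> C \<Longrightarrow> H \<le> G \<or> G \<le> H"
        using C unfolding Chains_def relation_of_def by auto
      have "Inf C \<noteq> bot"
      proof -
        \<comment> \<open>In the infimum of a chain, an event holds eventually only if it already
          does so in one member.\<close>
        have "eventually (\<lambda>_. False) (Inf C) \<longleftrightarrow> (\<exists>b\<in>C. eventually (\<lambda>_. False) b)"
          using False tot by (intro eventually_Inf_base) (auto simp: inf_absorb1 inf_absorb2)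
        with sub show ?thesis by (auto simp: trivial_limit_def)
      qed
      moreover have "Inf C \<le> F"
        using False sub by (metis (mono_tags, lifting) Inf_lower2 equals0I mem_Collect_eq subsetD)
      ultimately show ?thesis by (intro bexI[of _ "Inf C"]) (auto intro: Inf_lower)
    qed
  qed
  then obtain U where U: "U \<noteq> bot" "U \<le> F" and
    max: "\<And>G. G \<noteq> bot \<Longrightarrow> G \<le> U \<Longrightarrow> G = U" by (auto intro: order_trans)
  have "eventually P U \<or> eventually (\<lambda>n. \<not> P n) U" for P
  proof (cases "inf U (principal {n. P n}) = bot")
    case True
    then show ?thesis
      by (auto simp: trivial_limit_def eventually_inf_principal elim: eventually_mono)
  next
    case False
    then have "inf U (principal {n. P n}) = U" by (intro max) auto
    then have "U \<le> principal {n. P n}" by (metis inf_le2)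
    then show ?thesis by (simp add: le_principal)
  qed
  moreover have "infinite {n. P n}" if "eventually P U" for P
  proof
    assume "finite {n. P n}"
    then have "eventually (\<lambda>n. \<not> P n) cofinite" by (simp add: eventually_cofinite)
    then have "eventually (\<lambda>n. \<not> P n) sequentially" by (simp add: cofinite_eq_sequentially)
    then have "eventually (\<lambda>n. \<not> P n) U" using U assms by (meson filter_leD)
    with that have "eventually (\<lambda>_. False) U" by eventually_elim simp
    with U show False by (simp add: trivial_limit_def)
  qed
  ultimately show ?thesis
    using that U unfolding free_ultrafilter_def by blast
qed

text \<open>Since finite intersections of the \<open>J i\<close> are infinite, the
  \<open>J i\<close> and the cofinite sets together still generate a nontrivial filter.\<close>

lemma exists_ultrafilter_containing:
  fixes J :: "'i \<Rightarrow> nat set"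
  assumes "\<And>K. K \<subseteq> I \<Longrightarrow> finite K \<Longrightarrow> infinite (\<Inter>i\<in>K. J i)"
  obtains U where "free_ultrafilter U" "\<And>i. i \<in> I \<Longrightarrow> eventually (\<lambda>n. n \<in> J i) U"
proof -
  define F where "F = inf sequentially (INF i\<in>I. principal (J i))"
  \<comment> \<open>\<open>None\<close> indexes the cofinite filter, so that a single infimum
    comprises it and all \<open>J i\<close>.\<close>
  have "(INF i\<in>insert None (Some ` I). case i of None \<Rightarrow> sequentially | Some i \<Rightarrow> principal (J i)) \<noteq> bot"
  proof (rule INF_filter_not_bot)
    fix K assume K: "K \<subseteq> insert None (Some ` I)" "finite K"
    let ?K = "{i. Some i \<in> K}"
    have "finite ?K" using K(2) by (rule finite_surj[where f = the]) force
    moreover have "?K \<subseteq> I" using K(1) by auto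
    ultimately have inf: "infinite (\<Inter>i\<in>?K. J i)" using assms by blast
    have "inf sequentially (principal (\<Inter>i\<in>?K. J i)) \<noteq> bot"
      using inf by (simp add: trivial_limit_def eventually_inf_principal eventually_cofinite
          INTER_eq flip: cofinite_eq_sequentially)
    moreover have "inf sequentially (principal (\<Inter>i\<in>?K. J i)) \<le>
      (INF i\<in>K. case i of None \<Rightarrow> sequentially | Some i \<Rightarrow> principal (J i))"
      by (intro INF_greatest) (auto split: option.split intro: le_infI1 le_infI2)
    ultimately show "(INF i\<in>K. case i of None \<Rightarrow> sequentially | Some i \<Rightarrow> principal (J i)) \<noteq> bot"
      by (metis bot.extremum_uniqueI)
  qed
  then have "F \<noteq> bot" by (simp add: F_def image_image)
  then obtain U where "free_ultrafilter U" "U \<le> F"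
    using exists_free_ultrafilter_le F_def inf_le1 by metis
  moreover have "eventually (\<lambda>n. n \<in> J i) U" if "i \<in> I" for i
  proof -
    have "U \<le> principal (J i)"
      using \<open>U \<le> F\<close> that unfolding F_def by (meson INF_lower inf_le2 order_trans)
    then show ?thesis by (simp add: le_principal)
  qed
  ultimately show ?thesis using that by blast
qed

section \<open>Choosing points by recursion along a scale\<close>

text \<open>\<open>z i\<close> is chosen so that its set \<open>J i (z i)\<close> meets each finite
  intersection of earlier sets infinitely often. At each stage fewer than \<bb> gap functions, or
  finitely many, have to be respected, so one function \<open>h\<close> bounds them all.\<close>

lemma unbounded_modulo_ultrafilter:
  fixes S :: "'z \<Rightarrow> nat \<Rightarrow> nat" and r :: "'i rel" and q :: "'i \<Rightarrow> nat \<Rightarrow> nat"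
  assumes r: "Well_order r" "\<And>i. i \<in> Field r \<Longrightarrow> |underS r i| <o \<bb>"
    and q: "\<And>i. i \<in> Field r \<Longrightarrow> mono (q i)"
    and S: "\<And>z. z \<in> Z \<Longrightarrow> mono (S z)"
    and unb: "unbounded_family (S ` Z)"
  obtains z U where "free_ultrafilter U" "\<And>i. i \<in> Field r \<Longrightarrow> z i \<in> Z"
    "\<And>i. i \<in> Field r \<Longrightarrow> eventually (\<lambda>m. q i m \<le> S (z i) m) U"
proof -
  define J where "J i x = {m. q i m \<le> S x m}" for i x
  \<comment> \<open>Outside \<open>Field r\<close> the requirement is void, because the recursion
    produces a total function.\<close>
  define P where "P f i x \<longleftrightarrow> (i \<in> Field r \<longrightarrow> x \<in> Z \<and> 
    (\<forall>K. K \<subseteq> underS r i \<and> finite K \<longrightarrow> infinite (J i x \<inter> (\<Inter>j\<in>K. J j (f j)))))" for f i x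
  have lin: "Linear_order r" and wf: "wf (r - Id)"
    using r(1) by (auto simp: well_order_on_def)
  \<comment> \<open>The requirement at the largest index of a finite \<open>K\<close> already says
    that the intersection over all of \<open>K\<close> is infinite.\<close>
  have max: "\<exists>m\<in>K. K - {m} \<subseteq> underS r m" if "finite K" "K \<noteq> {}" "K \<subseteq> Field r" for K
    using that
  proof (induction K rule: finite_ne_induct)
    case (insert x K)
    then obtain m where m: "m \<in> K" "K - {m} \<subseteq> underS r m" by auto
    have trans: "trans r" and tot: "total_on (Field r) r"
      using lin by (auto simp: linear_order_on_def partial_order_on_def preorder_on_def)
    have anti: "antisym r" using lin by (auto simp: linear_order_on_def partial_order_on_def)
    have "x \<noteq> m" using m insert by auto
    then consider "(x, m) \<in> r" | "(m, x) \<in> r"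
      using tot m insert unfolding total_on_def by blast
    then show ?case
    proof cases
      case 1
      then have "insert x K - {m} \<subseteq> underS r m" using m \<open>x \<noteq> m\<close> by (auto simp: underS_def)
      with m show ?thesis by blast
    next
      case 2
      then have "y \<in> underS r x" if "y \<in> K" for y
        using that m \<open>x \<noteq> m\<close> trans anti insert.hyps unfolding underS_def trans_def antisym_def by blast
      then show ?thesis by blast
    qed
  qed auto
  have fip: "infinite (\<Inter>j\<in>K. J j (f j))"
    if P: "\<And>y. y \<in> K \<Longrightarrow> P f y (f y)" and K: "K \<subseteq> Field r" "finite K" for f K
  proof (cases "K = {}")
    case False
    then obtain m where m: "m \<in> K" "K - {m} \<subseteq> underS r m"
      using max[OF K(2) False K(1)] by blast
    then have "infinite (J m (f m) \<inter> (\<Inter>j\<in>K - {m}. J j (f j)))"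
      using P[of m] K unfolding P_def by auto
    moreover have "J m (f m) \<inter> (\<Inter>j\<in>K - {m}. J j (f j)) = (\<Inter>j\<in>K. J j (f j))"
      using m(1) by auto
    ultimately show ?thesis by metis
  qed simp
  have "\<exists>f. \<forall>i. P f i (f i)"
  proof (rule dependent_wf_choice[OF wf])
    fix f g :: "'i \<Rightarrow> 'z" and i x
    assume "\<And>j. (j, i) \<in> r - Id \<Longrightarrow> f j = g j"
    then have "f j = g j" if "j \<in> underS r i" for j
      using that by (auto simp: underS_def)
    then have "(\<Inter>j\<in>K. J j (f j)) = (\<Inter>j\<in>K. J j (g j))" if "K \<subseteq> underS r i" for K
      using that by (intro INF_cong) auto
    then show "P f i x = P g i x"
      unfolding P_def by (simp cong: conj_cong)
  next
    fix i and f :: "'i \<Rightarrow> 'z"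
    assume IH: "\<And>j. (j, i) \<in> r - Id \<Longrightarrow> P f j (f j)"
    show "\<exists>x. P f i x"
    proof (cases "i \<in> Field r")
      case i: True
      define B where "B K = (\<Inter>j\<in>K. J j (f j))" for K
      have B: "infinite (B K)" if "K \<subseteq> underS r i" "finite K" for K
        unfolding B_def using that
        by (intro fip IH) (auto simp: underS_def Field_def)
      \<comment> \<open>\<open>N K n\<close> is the first element of \<open>B K\<close> from
        \<open>n\<close> on, so it measures the gaps of \<open>B K\<close>.\<close>
      define N where "N K n = (LEAST m. n \<le> m \<and> m \<in> B K)" for K n
      have N: "n \<le> N K n \<and> N K n \<in> B K" if "K \<subseteq> underS r i" "finite K" for K n
      proof -
        have "\<exists>m. n \<le> m \<and> m \<in> B K" using B[OF that] by (meson infinite_nat_iff_unbounded_le)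
        then show ?thesis unfolding N_def by (rule LeastI_ex)
      qed
      obtain h where h: "\<And>K. K \<subseteq> underS r i \<Longrightarrow> finite K \<Longrightarrow> N K \<le>\<^sup>* h"
        using bounded_on_finite_subsets[OF r(2)[OF i]] by blast
      \<comment> \<open>\<open>S x n\<close> exceeds \<open>q i (h n)\<close> for infinitely many
        \<open>n\<close>. As \<open>N K n\<close> lies between \<open>n\<close> and
        \<open>h n\<close> for large \<open>n\<close>, monotonicity of \<open>S x\<close> and
        \<open>q i\<close> turns this into \<open>q i (N K n) \<le> S x (N K n)\<close> at an
        element of \<open>B K\<close>.\<close>
      obtain x where x: "x \<in> Z" "\<not> S x \<le>\<^sup>* (\<lambda>n. q i (h n))"
        using unb unfolding unbounded_family_def by blast
      have "infinite (J i x \<inter> B K)" if K: "K \<subseteq> underS r i" "finite K" for K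
        unfolding infinite_nat_iff_unbounded_le
      proof
        fix n0
        obtain n1 where n1: "\<And>n. n \<ge> n1 \<Longrightarrow> N K n \<le> h n"
          using h[OF K] unfolding eventually_dominated_def eventually_sequentially by blast
        obtain n where n: "n \<ge> max n0 n1" "q i (h n) < S x n"
          using x(2) unfolding eventually_dominated_def eventually_sequentially
          by (meson not_le)
        have "q i (N K n) \<le> q i (h n)" using q[OF i] n1[of n] n by (simp add: monoD)
        also have "\<dots> \<le> S x n" using n by simp
        also have "\<dots> \<le> S x (N K n)" using S[OF x(1)] N[OF K] by (simp add: monoD)
        finally have "N K n \<in> J i x" by (simp add: J_def)
        then show "\<exists>m\<ge>n0. m \<in> J i x \<inter> B K"
          using N[OF K, of n] n by (intro exI[of _ "N K n"]) auto
      qed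
      with x have "P f i x" unfolding P_def B_def by blast
      then show ?thesis ..
    qed (auto simp: P_def)
  qed
  then obtain z where z: "\<And>i. P z i (z i)" by blast
  obtain U where "free_ultrafilter U" "\<And>i. i \<in> Field r \<Longrightarrow> eventually (\<lambda>m. m \<in> J i (z i)) U"
    using exists_ultrafilter_containing[of "Field r" "\<lambda>i. J i (z i)"] fip[OF z] by blast
  then show ?thesis
    using that[of U z] z unfolding P_def J_def by simp
qed

section \<open>Cardinality of hereditarily Lindelof spaces\<close>

lemma countable_iff_le_natLeq: "countable A \<longleftrightarrow> |A| \<le>o natLeq"
proof -
  have "|A| \<le>o natLeq \<longleftrightarrow> |A| \<le>o |UNIV :: nat set|"
    using card_of_nat ordIso_symmetric ordLeq_ordIso_trans by blast
  then show ?thesis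
    unfolding countable_def by (simp flip: card_of_ordLeq)
qed

text \<open>\<open>cardSuc natLeq\<close> plays the part of the ordinal \<omega>_1: being smaller
  than a successor cardinal means being at most its predecessor.\<close>

lemma countable_below_cardSuc_natLeq:
  assumes "\<alpha> \<in> Field (cardSuc natLeq)"
  shows "countable (underS (cardSuc natLeq) \<alpha>)"
proof -
  have "|underS (cardSuc natLeq) \<alpha>| <o cardSuc natLeq"
    using assms by (intro card_of_underS cardSuc_Card_order natLeq_Card_order)
  then show ?thesis
    by (simp add: countable_iff_le_natLeq cardSuc_ordLeq_ordLess[OF natLeq_Card_order card_of_Card_order])
qed

text \<open>Regularity of \<omega>_1: if \<open>B\<close> had no strict upper bound, the field would
  be a countable union of countable segments.\<close>

lemma countable_bounded_in_cardSuc_natLeq: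
  assumes "countable B" "B \<subseteq> Field (cardSuc natLeq)"
  obtains \<gamma> where "\<gamma> \<in> Field (cardSuc natLeq)" "B \<subseteq> underS (cardSuc natLeq) \<gamma>"
proof -
  let ?r = "cardSuc natLeq"
  have co: "Card_order ?r" by (intro cardSuc_Card_order natLeq_Card_order)
  then have tot: "total_on (Field ?r) ?r"
    by (auto simp: card_order_on_def well_order_on_def linear_order_on_def
        partial_order_on_def preorder_on_def)
  have "\<exists>\<gamma>\<in>Field ?r. B \<subseteq> underS ?r \<gamma>"
  proof (rule ccontr)
    assume unb: "\<not> (\<exists>\<gamma>\<in>Field ?r. B \<subseteq> underS ?r \<gamma>)"
    have "\<gamma> \<in> (\<Union>\<beta>\<in>B. insert \<beta> (underS ?r \<beta>))" if \<gamma>: "\<gamma> \<in> Field ?r" for \<gamma>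
    proof -
      obtain \<beta> where \<beta>: "\<beta> \<in> B" "\<beta> \<notin> underS ?r \<gamma>"
        using unb \<gamma> by blast
      then have "\<gamma> = \<beta> \<or> (\<gamma>, \<beta>) \<in> ?r"
        using tot \<gamma> assms(2) unfolding total_on_def underS_def by auto
      with \<beta>(1) show ?thesis by (auto simp: underS_def)
    qed
    then have "Field ?r \<subseteq> (\<Union>\<beta>\<in>B. insert \<beta> (underS ?r \<beta>))" by blast
    moreover have "countable (\<Union>\<beta>\<in>B. insert \<beta> (underS ?r \<beta>))"
      using assms countable_below_cardSuc_natLeq by blast
    ultimately have "|Field ?r| \<le>o natLeq"
      using countable_subset countable_iff_le_natLeq by blast
    then have "?r \<le>o natLeq"
      using card_of_Field_ordIso[OF co] ordIso_ordLeq_trans ordIso_symmetric by blast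
    then show False
      using cardSuc_greater[OF natLeq_Card_order] not_ordLess_ordLeq by blast
  qed
  then show ?thesis using that by blast
qed

text \<open>Pairs arise because a stage in \<open>cardSuc natLeq\<close> is itself a set of
  naturals, and a second set records the choices. The encoded disjoint sum of a pair determines both
  parts.\<close>

lemma nat_set_times_nat_set_inj_real: "\<exists>f :: nat set \<times> nat set \<Rightarrow> real. inj f"
proof -
  have "inj (\<lambda>(A, B). sum_encode ` (A <+> B))"
    by (rule injI, clarsimp simp: inj_image_eq_iff[OF inj_sum_encode] Plus_def) blast
  moreover obtain g :: "nat set \<Rightarrow> real" where "inj g"
    using nat_sets_eqpoll_reals unfolding eqpoll_def bij_betw_def by blast
  ultimately show ?thesis
    using inj_compose by blast
qed

text \<open>
  De Groot's bound: split each closed set with at least two points into two proper closed subsets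
  \<open>L F\<close> and \<open>R F\<close>. Following the half that contains \<open>x\<close> (and intersecting at limits) gives a
  decreasing chain of closed sets, which reaches \<open>{x}\<close> at a countable stage because the
  complements cannot increase \<open>\<omega>\<^sub>1\<close> times; the choices made on the way code \<open>x\<close>.
\<close>

lemma Hausdorff_hereditarily_Lindelof_inj_real:
  fixes Y :: "'c topology"
  assumes H: "Hausdorff_space Y" and hL: "hereditarily Lindelof_space Y"
  shows "\<exists>f :: 'c \<Rightarrow> real. inj_on f (topspace Y)"
proof -
  let ?r = "cardSuc natLeq"
  have co: "Card_order ?r" by (intro cardSuc_Card_order natLeq_Card_order)
  then have lin: "Linear_order ?r" and wf: "wf (?r - Id)"
    by (auto simp: card_order_on_def well_order_on_def)
  then have trans: "trans ?r" and antisym: "antisym ?r"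
    by (auto simp: linear_order_on_def partial_order_on_def preorder_on_def)
  have under_trans: "\<beta> \<in> underS ?r \<gamma> \<Longrightarrow> \<gamma> \<in> underS ?r \<alpha> \<Longrightarrow> \<beta> \<in> underS ?r \<alpha>" for \<alpha> \<beta> \<gamma>
    using trans antisym unfolding underS_def trans_def antisym_def by blast
  have inf: "infinite (Field ?r)"
    by (simp add: cardSuc_finite[OF natLeq_Card_order] Field_natLeq)
  have under_induct: "P \<alpha>" if "\<And>\<alpha>. (\<And>\<beta>. \<beta> \<in> underS ?r \<alpha> \<Longrightarrow> P \<beta>) \<Longrightarrow> P \<alpha>" for P \<alpha>
    using wf by (induction rule: wf_induct_rule) (auto intro: that simp: underS_def)

  \<comment> \<open>Removing one of two disjoint neighbourhoods of distinct points leaves a proper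
    closed part, and the two parts cover \<open>F\<close>. If \<open>F\<close> has at most one
    point, both parts are \<open>F\<close>.\<close>
  have "\<exists>L R. closedin Y L \<and> closedin Y R \<and> L \<union> R = F \<and>
      (\<forall>x\<in>F. F \<noteq> {x} \<longrightarrow> L \<noteq> F \<and> R \<noteq> F)" if F: "closedin Y F" for F
  proof (cases "\<exists>x\<in>F. \<exists>y\<in>F. x \<noteq> y")
    case True
    then obtain x y where xy: "x \<in> F" "y \<in> F" "x \<noteq> y" by blast
    then obtain U V where UV: "openin Y U" "openin Y V" "x \<in> U" "y \<in> V" "disjnt U V"
      using H closedin_subset[OF F] unfolding Hausdorff_space_def by (meson subsetD)
    have "closedin Y (F - U)" "closedin Y (F - V)" using F UV by (auto intro: closedin_diff)
    moreover have "(F - U) \<union> (F - V) = F" using UV(5) by (auto simp: disjnt_iff)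
    moreover have "F - U \<noteq> F" "F - V \<noteq> F" using UV xy by auto
    ultimately show ?thesis by blast
  next
    case False
    with F show ?thesis by (intro exI[of _ F]) blast
  qed
  then obtain L R where LR: "\<And>F. closedin Y F \<Longrightarrow> closedin Y (L F)" "\<And>F. closedin Y F \<Longrightarrow> closedin Y (R F)"
    "\<And>F. closedin Y F \<Longrightarrow> L F \<union> R F = F"
    "\<And>F x. closedin Y F \<Longrightarrow> x \<in> F \<Longrightarrow> F \<noteq> {x} \<Longrightarrow> L F \<noteq> F \<and> R F \<noteq> F"
    by metis
  define step where "step x F = (if x \<in> L F then L F else R F)" for x F
  have step: "closedin Y (step x F)" "x \<in> step x F" "step x F \<subseteq> F" "F \<noteq> {x} \<Longrightarrow> step x F \<noteq> F"
    if "closedin Y F" "x \<in> F" for x F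
    using that LR(1,2,4)[of F] LR(3)[of F] unfolding step_def by auto
  \<comment> \<open>The factor \<open>topspace Y\<close> gives the right value at the first stage,
    where the intersection over no predecessors would be the whole type.\<close>
  have "\<exists>C. \<forall>\<alpha>. C \<alpha> = topspace Y \<inter> (\<Inter>\<beta>\<in>underS ?r \<alpha>. step x (C \<beta>))" for x
  proof (rule dependent_wf_choice[OF wf])
    fix f g :: "nat set \<Rightarrow> 'c set" and \<alpha> F
    assume "\<And>\<beta>. (\<beta>, \<alpha>) \<in> ?r - Id \<Longrightarrow> f \<beta> = g \<beta>"
    then have "(\<Inter>\<beta>\<in>underS ?r \<alpha>. step x (f \<beta>)) = (\<Inter>\<beta>\<in>underS ?r \<alpha>. step x (g \<beta>))"
      by (intro INF_cong) (auto simp: underS_def)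
    then show "(F = topspace Y \<inter> (\<Inter>\<beta>\<in>underS ?r \<alpha>. step x (f \<beta>))) \<longleftrightarrow>
      (F = topspace Y \<inter> (\<Inter>\<beta>\<in>underS ?r \<alpha>. step x (g \<beta>)))" by simp
  qed blast
  then obtain C where C: "\<And>x \<alpha>. C x \<alpha> = topspace Y \<inter> (\<Inter>\<beta>\<in>underS ?r \<alpha>. step x (C x \<beta>))"
    by metis
  have C_closed: "closedin Y (C x \<alpha>) \<and> x \<in> C x \<alpha>" if "x \<in> topspace Y" for x \<alpha>
  proof (induction \<alpha> rule: under_induct)
    case (1 \<alpha>)
    show ?case
    proof (cases "underS ?r \<alpha> = {}")
      case True
      with that show ?thesis by (subst (1 2) C) simp
    next
      case False
      with 1 that step show ?thesis by (subst (1 2) C) (auto intro!: closedin_Int closedin_INT)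
    qed
  qed
  have C_step: "C x \<alpha> \<subseteq> step x (C x \<beta>)" if "\<beta> \<in> underS ?r \<alpha>" for x \<alpha> \<beta>
    using that by (subst C) blast
  have reach: "\<exists>\<alpha>\<in>Field ?r. C x \<alpha> = {x}" if x: "x \<in> topspace Y" for x
  proof (rule ccontr)
    assume nex: "\<not> (\<exists>\<alpha>\<in>Field ?r. C x \<alpha> = {x})"
    have strict: "step x (C x \<alpha>) \<subset> C x \<alpha>" if "\<alpha> \<in> Field ?r" for \<alpha>
      using that nex step(3,4)[of "C x \<alpha>" x] C_closed[OF x, of \<alpha>] by auto
    \<comment> \<open>Countably many complements already have union \<open>?O\<close>. At a stage
      \<gamma> above all their indices the chain can therefore not shrink any further, contrary to
      \<open>strict\<close>.\<close>
    let ?O = "\<Union>\<alpha>\<in>Field ?r. topspace Y - C x \<alpha>"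
    have "Lindelof_space (subtopology Y ?O)"
      using hL by (simp add: hereditarily)
    moreover have "?O \<subseteq> topspace Y" by blast
    moreover have "\<forall>V\<in>(\<lambda>\<alpha>. topspace Y - C x \<alpha>) ` Field ?r. openin Y V"
      using C_closed[OF x] by auto
    ultimately have "\<exists>V. countable V \<and> V \<subseteq> (\<lambda>\<alpha>. topspace Y - C x \<alpha>) ` Field ?r \<and> ?O \<subseteq> \<Union>V"
      using Lindelof_space_subtopology_subset[of ?O Y] by (metis (no_types, lifting) order_refl)
    then obtain B where B: "countable B" "B \<subseteq> Field ?r" "?O \<subseteq> (\<Union>\<alpha>\<in>B. topspace Y - C x \<alpha>)"
      by (metis (no_types, lifting) countable_subset_image)
    then obtain \<gamma> where \<gamma>: "\<gamma> \<in> Field ?r" "B \<subseteq> underS ?r \<gamma>"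
      using countable_bounded_in_cardSuc_natLeq by blast
    obtain \<gamma>' where \<gamma>': "\<gamma>' \<in> Field ?r" "\<gamma> \<in> underS ?r \<gamma>'"
      using infinite_Card_order_limit[OF co inf \<gamma>(1)] by (auto simp: underS_def)
    obtain y where y: "y \<in> C x \<gamma>" "y \<notin> C x \<gamma>'"
      using strict[OF \<gamma>(1)] C_step[OF \<gamma>'(2)] by blast
    then have "y \<in> ?O" using \<gamma>'(1) closedin_subset C_closed[OF x] by blast
    then obtain \<beta> where \<beta>: "\<beta> \<in> B" "y \<notin> C x \<beta>" using B(3) by blast
    then show False
      using y(1) C_step[of \<beta> \<gamma> x] strict[of \<beta>] \<gamma>(2) B(2) by blast
  qed
  then obtain a where a: "\<And>x. x \<in> topspace Y \<Longrightarrow> a x \<in> Field ?r"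
    "\<And>x. x \<in> topspace Y \<Longrightarrow> C x (a x) = {x}" by metis
  obtain e where e: "\<And>\<alpha>. \<alpha> \<in> Field ?r \<Longrightarrow> inj_on (e \<alpha> :: nat set \<Rightarrow> nat) (underS ?r \<alpha>)"
    using countable_below_cardSuc_natLeq unfolding countable_def by metis
  \<comment> \<open>The injection \<open>e (a x)\<close> turns the countably many stages at which
    \<open>x\<close> went to the half \<open>L\<close> into naturals; it depends on
    \<open>a x\<close>, which the first component records.\<close>
  define code where "code x = (a x, e (a x) ` {\<beta> \<in> underS ?r (a x). x \<in> L (C x \<beta>)})" for x
  have "inj_on code (topspace Y)"
  proof (rule inj_onI)
    fix x y assume xy: "x \<in> topspace Y" "y \<in> topspace Y" "code x = code y"
    then have ax: "a x = a y" by (simp add: code_def)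
    have "{\<beta> \<in> underS ?r (a x). x \<in> L (C x \<beta>)} = {\<beta> \<in> underS ?r (a x). y \<in> L (C y \<beta>)}"
      using xy(3) unfolding code_def ax
      by (subst inj_on_image_eq_iff[OF e[OF a(1)[OF xy(2)]], symmetric]) auto
    then have L: "x \<in> L (C x \<beta>) \<longleftrightarrow> y \<in> L (C y \<beta>)" if "\<beta> \<in> underS ?r (a x)" for \<beta>
      using that by blast
    \<comment> \<open>Equal choices before the common final stage yield equal chains, which end in
      \<open>{x}\<close> and in \<open>{y}\<close>.\<close>
    have "\<gamma> = a x \<or> \<gamma> \<in> underS ?r (a x) \<longrightarrow> C x \<gamma> = C y \<gamma>" for \<gamma>
    proof (induction \<gamma> rule: under_induct)
      case (1 \<gamma>)
      show ?case
      proof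
        assume "\<gamma> = a x \<or> \<gamma> \<in> underS ?r (a x)"
        then have "step x (C x \<beta>) = step y (C y \<beta>)" if "\<beta> \<in> underS ?r \<gamma>" for \<beta>
          using that 1[of \<beta>] under_trans[of \<beta> \<gamma> "a x"] L[of \<beta>] unfolding step_def by auto
        then show "C x \<gamma> = C y \<gamma>" by (subst (1 2) C) auto
      qed
    qed
    then show "x = y" using a(2) xy ax by (metis singleton_inject)
  qed
  moreover obtain g :: "nat set \<times> nat set \<Rightarrow> real" where "inj g"
    using nat_set_times_nat_set_inj_real by blast
  ultimately have "inj_on (g \<circ> code) (topspace Y)"
    using comp_inj_on inj_on_subset by blast
  then show ?thesis by blast
qed

section \<open>Continuous images\<close>

lemma exists_homeomorphic_real_topology:
  assumes "inj_on (f :: 'c \<Rightarrow> real) (topspace T)"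
  obtains T' :: "real topology" and g where "homeomorphic_maps T T' f g"
proof -
  define g where "g = the_inv_into (topspace T) f"
  define T' where "T' = pullback_topology (f ` topspace T) g T"
  have gf: "g (f x) = x" if "x \<in> topspace T" for x
    using that assms by (simp add: g_def the_inv_into_f_f)
  have top: "topspace T' = f ` topspace T"
    unfolding T'_def topspace_pullback_topology using gf by auto
  have "continuous_map T T' f"
    unfolding continuous_map_def top
  proof (intro conjI allI impI)
    fix V assume "openin T' V"
    then obtain U where U: "openin T U" "V = g -` U \<inter> f ` topspace T"
      unfolding T'_def openin_pullback_topology by blast
    have "f x \<in> V \<longleftrightarrow> x \<in> U" if "x \<in> topspace T" for x
      using that gf unfolding U(2) by simp
    then have "{x \<in> topspace T. f x \<in> V} = U"
      using openin_subset[OF U(1)] by blast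
    with U(1) show "openin T {x \<in> topspace T. f x \<in> V}" by simp
  qed auto
  moreover have "continuous_map T' T g"
    unfolding continuous_map_def top
  proof (intro conjI allI impI)
    fix U assume "openin T U"
    moreover have "{y \<in> f ` topspace T. g y \<in> U} = g -` U \<inter> f ` topspace T" by auto
    ultimately show "openin T' {y \<in> f ` topspace T. g y \<in> U}"
      unfolding T'_def openin_pullback_topology by blast
  qed (auto simp: gf)
  ultimately have "homeomorphic_maps T T' f g"
    using gf top by (auto simp: homeomorphic_maps_def)
  then show ?thesis using that by blast
qed

lemma hereditarily_Lindelof_continuous_image:
  assumes "hereditarily Lindelof_space T" "continuous_map T T' f" "f ` topspace T = topspace T'"
  shows "hereditarily Lindelof_space T'"
  unfolding hereditarily_def
proof (intro allI impI)
  fix S assume S: "S \<subseteq> topspace T'"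
  let ?P = "{x \<in> topspace T. f x \<in> S}"
  have "S \<subseteq> f ` topspace T" using S assms(3) by simp
  then have "f ` ?P = S" by blast
  then have "f ` topspace (subtopology T ?P) = topspace (subtopology T' S)"
    using S by (simp add: topspace_subtopology_subset Int_absorb1 subsetI)
  moreover have "continuous_map (subtopology T ?P) (subtopology T' S) f"
    using assms(2) by (simp add: continuous_map_in_subtopology continuous_map_from_subtopology Pi_def)
  moreover have "Lindelof_space (subtopology T ?P)"
    using assms(1) by (simp add: hereditarily)
  ultimately show "Lindelof_space (subtopology T' S)"
    using Lindelof_space_continuous_map_image by blast
qed

text \<open>A finite set of preimages comes from a finite set of members of the cover. The pointwise
  equivalence makes the lemma usable for every way of counting the indices that catch a
  point.\<close>

lemma pullback_open_covers:
  fixes \<U> :: "nat \<Rightarrow> 'b set set"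
  assumes f: "continuous_map X Y f" "f ` topspace X = topspace Y"
    and \<U>: "\<And>n. open_cover Y (\<U> n)"
  defines "\<V> \<equiv> \<lambda>n. (\<lambda>U. {x \<in> topspace X. f x \<in> U}) ` \<U> n"
  shows "open_cover X (\<V> n)"
    and "(\<And>n. finite (\<F> n) \<and> \<F> n \<subseteq> \<V> n) \<Longrightarrow>
      \<exists>\<G>. (\<forall>n. finite (\<G> n) \<and> \<G> n \<subseteq> \<U> n) \<and>
        (\<forall>n. \<forall>x\<in>topspace X. f x \<in> \<Union>(\<G> n) \<longleftrightarrow> x \<in> \<Union>(\<F> n))"
proof -
  have "f x \<in> \<Union>(\<U> n)" if "x \<in> topspace X" for x
    using that \<U>[of n] by (simp add: open_cover_def flip: f(2))
  then have "\<Union>(\<V> n) = topspace X"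
    by (auto simp: \<V>_def)
  moreover have "openin X V" if "V \<in> \<V> n" for V
    using that f(1) \<U>[of n] unfolding open_cover_def \<V>_def
    by (auto intro: openin_continuous_map_preimage)
  ultimately show "open_cover X (\<V> n)"
    by (simp add: open_cover_def)
next
  assume \<F>: "\<And>n. finite (\<F> n) \<and> \<F> n \<subseteq> \<V> n"
  have "\<exists>G. finite G \<and> G \<subseteq> \<U> n \<and> \<F> n = (\<lambda>U. {x \<in> topspace X. f x \<in> U}) ` G" for n
    using finite_subset_image[of "\<F> n" "\<lambda>U. {x \<in> topspace X. f x \<in> U}" "\<U> n"] \<F>[of n]
    unfolding \<V>_def by blast
  then have "\<exists>\<G>. \<forall>n. finite (\<G> n) \<and> \<G> n \<subseteq> \<U> n \<and>
      \<F> n = (\<lambda>U. {x \<in> topspace X. f x \<in> U}) ` \<G> n"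
    by (intro choice allI)
  then obtain \<G> where \<G>: "\<forall>n. finite (\<G> n) \<and> \<G> n \<subseteq> \<U> n \<and>
      \<F> n = (\<lambda>U. {x \<in> topspace X. f x \<in> U}) ` \<G> n" ..
  then show "\<exists>\<G>. (\<forall>n. finite (\<G> n) \<and> \<G> n \<subseteq> \<U> n) \<and>
        (\<forall>n. \<forall>x\<in>topspace X. f x \<in> \<Union>(\<G> n) \<longleftrightarrow> x \<in> \<Union>(\<F> n))"
    by (intro exI[of _ \<G>]) (simp add: \<G>)
qed

lemma Menger_spaceE:
  fixes \<U> :: "nat \<Rightarrow> 'a set set"
  assumes "Menger_space X" "\<And>n. open_cover X (\<U> n)"
  obtains \<F> where "\<And>n. finite (\<F> n)" "\<And>n. \<F> n \<subseteq> \<U> n" "\<And>x. x \<in> topspace X \<Longrightarrow> \<exists>n. x \<in> \<Union>(\<F> n)"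
proof -
  have "\<exists>\<F>. (\<forall>n. finite (\<F> n) \<and> \<F> n \<subseteq> \<U> n) \<and> (\<Union>n. \<Union>(\<F> n)) = topspace X"
    by (intro assms(1)[unfolded Menger_space_def, THEN spec, THEN mp] allI assms(2))
  then obtain \<F> where \<F>: "\<forall>n. finite (\<F> n) \<and> \<F> n \<subseteq> \<U> n" "(\<Union>n. \<Union>(\<F> n)) = topspace X"
    by (elim exE conjE)
  show ?thesis
  proof (rule that)
    show "\<exists>n. x \<in> \<Union>(\<F> n)" if "x \<in> topspace X" for x
      using that unfolding \<F>(2)[symmetric] by blast
  qed (use \<F>(1) in auto)
qed

lemma Menger_spaceI:
  assumes "\<And>\<U> :: nat \<Rightarrow> 'a set set. (\<And>n. open_cover X (\<U> n)) \<Longrightarrow>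
    \<exists>\<F>. (\<forall>n. finite (\<F> n) \<and> \<F> n \<subseteq> \<U> n) \<and> (\<forall>x\<in>topspace X. \<exists>n. x \<in> \<Union>(\<F> n))"
  shows "Menger_space (X :: 'a topology)"
  unfolding Menger_space_def
proof (intro allI impI)
  fix \<U> :: "nat \<Rightarrow> 'a set set" assume \<U>: "\<forall>n. open_cover X (\<U> n)"
  obtain \<F> where \<F>: "\<forall>n. finite (\<F> n) \<and> \<F> n \<subseteq> \<U> n" "\<forall>x\<in>topspace X. \<exists>n. x \<in> \<Union>(\<F> n)"
    using assms[of \<U>, OF \<U>[rule_format]] by (elim exE conjE)
  have "\<Union>(\<F> n) \<subseteq> topspace X" for n
  proof -
    have "\<Union>(\<F> n) \<subseteq> \<Union>(\<U> n)" using \<F>(1) by (intro Union_mono) simp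
    with \<U> show ?thesis by (simp add: open_cover_def)
  qed
  then have "(\<Union>n. \<Union>(\<F> n)) = topspace X"
    using \<F>(2) by (intro antisym UN_least) auto
  with \<F>(1) show "\<exists>\<F>. (\<forall>n. finite (\<F> n) \<and> \<F> n \<subseteq> \<U> n) \<and> (\<Union>n. \<Union>(\<F> n)) = topspace X"
    by (intro exI[of _ \<F>]) simp
qed

lemma ultrafilter_Menger_spaceE:
  fixes \<U> :: "nat \<Rightarrow> 'a set set"
  assumes "ultrafilter_Menger_space U X" "\<And>n. open_cover X (\<U> n)"
  obtains \<F> where "\<And>n. finite (\<F> n)" "\<And>n. \<F> n \<subseteq> \<U> n"
    "\<And>x. x \<in> topspace X \<Longrightarrow> \<forall>\<^sub>F n in U. x \<in> \<Union>(\<F> n)"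
proof -
  have "\<exists>\<F>. (\<forall>n. finite (\<F> n) \<and> \<F> n \<subseteq> \<U> n) \<and>
      (\<forall>x\<in>topspace X. \<forall>\<^sub>F n in U. x \<in> \<Union>(\<F> n))"
    by (intro assms(1)[unfolded ultrafilter_Menger_space_def, THEN spec, THEN mp] allI assms(2))
  then obtain \<F> where \<F>: "\<forall>n. finite (\<F> n) \<and> \<F> n \<subseteq> \<U> n"
    "\<forall>x\<in>topspace X. \<forall>\<^sub>F n in U. x \<in> \<Union>(\<F> n)"
    by (elim exE conjE)
  then show ?thesis by (intro that[of \<F>]) simp_all
qed

lemma Menger_space_continuous_image:
  assumes X: "Menger_space X" and f: "continuous_map X Y f" "f ` topspace X = topspace Y"
  shows "Menger_space Y"
proof (rule Menger_spaceI)
  fix \<U> :: "nat \<Rightarrow> 'b set set" assume \<U>: "\<And>n. open_cover Y (\<U> n)"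
  note cov = pullback_open_covers[of X Y f \<U>, OF f \<U>]
  obtain \<F> where \<F>: "\<And>n. finite (\<F> n)" "\<And>n. \<F> n \<subseteq> (\<lambda>U. {x \<in> topspace X. f x \<in> U}) ` \<U> n"
    "\<And>x. x \<in> topspace X \<Longrightarrow> \<exists>n. x \<in> \<Union>(\<F> n)"
    by (rule Menger_spaceE[of X "\<lambda>n. (\<lambda>U. {x \<in> topspace X. f x \<in> U}) ` \<U> n", OF X cov(1)]) (rule that; assumption)
  obtain \<G> where \<G>: "\<forall>n. finite (\<G> n) \<and> \<G> n \<subseteq> \<U> n"
    "\<forall>n. \<forall>x\<in>topspace X. f x \<in> \<Union>(\<G> n) \<longleftrightarrow> x \<in> \<Union>(\<F> n)"
    using cov(2)[of \<F>, OF conjI, OF \<F>(1,2)] by (elim exE conjE)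
  have "\<exists>n. y \<in> \<Union>(\<G> n)" if y: "y \<in> topspace Y" for y
  proof -
    obtain x where x: "x \<in> topspace X" "y = f x"
      using y unfolding f(2)[symmetric] by auto
    then show ?thesis using \<F>(3)[OF x(1)] \<G>(2) by simp
  qed
  then show "\<exists>\<G>. (\<forall>n. finite (\<G> n) \<and> \<G> n \<subseteq> \<U> n) \<and> (\<forall>y\<in>topspace Y. \<exists>n. y \<in> \<Union>(\<G> n))"
    using \<G>(1) by (intro exI[of _ \<G>]) simp
qed

lemma ultrafilter_Menger_space_continuous_image:
  assumes X: "ultrafilter_Menger_space U X" and f: "continuous_map X Y f" "f ` topspace X = topspace Y"
  shows "ultrafilter_Menger_space U Y"
  unfolding ultrafilter_Menger_space_def
proof (intro allI impI)
  fix \<U> :: "nat \<Rightarrow> 'b set set" assume \<U>: "\<forall>n. open_cover Y (\<U> n)"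
  note cov = pullback_open_covers[of X Y f \<U>, OF f \<U>[rule_format]]
  obtain \<F> where \<F>: "\<And>n. finite (\<F> n)" "\<And>n. \<F> n \<subseteq> (\<lambda>U. {x \<in> topspace X. f x \<in> U}) ` \<U> n"
    "\<And>x. x \<in> topspace X \<Longrightarrow> \<forall>\<^sub>F n in U. x \<in> \<Union>(\<F> n)"
    by (rule ultrafilter_Menger_spaceE[of U X "\<lambda>n. (\<lambda>U. {x \<in> topspace X. f x \<in> U}) ` \<U> n", OF X cov(1)]) (rule that; assumption)
  obtain \<G> where \<G>: "\<forall>n. finite (\<G> n) \<and> \<G> n \<subseteq> \<U> n"
    "\<forall>n. \<forall>x\<in>topspace X. f x \<in> \<Union>(\<G> n) \<longleftrightarrow> x \<in> \<Union>(\<F> n)"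
    using cov(2)[of \<F>, OF conjI, OF \<F>(1,2)] by (elim exE conjE)
  have "\<forall>\<^sub>F n in U. y \<in> \<Union>(\<G> n)" if y: "y \<in> topspace Y" for y
  proof -
    obtain x where x: "x \<in> topspace X" "y = f x"
      using y unfolding f(2)[symmetric] by auto
    then show ?thesis using \<F>(3)[OF x(1)] \<G>(2) by simp
  qed
  then show "\<exists>\<G>. (\<forall>n. finite (\<G> n) \<and> \<G> n \<subseteq> \<U> n) \<and>
      (\<forall>y\<in>topspace Y. \<forall>\<^sub>F n in U. y \<in> \<Union>(\<G> n))"
    using \<G>(1) by (intro exI[of _ \<G>]) simp
qed

text \<open>The hypothesis speaks of topologies on the reals, whereas the spaces constructed later
  have other points. De Groot's bound provides a homeomorphic copy of \<open>T\<close> on a set of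
  reals, and the product with the copy maps continuously onto the product with
  \<open>T\<close>.\<close>

lemma Menger_product_transfer:
  fixes X :: "'a topology" and T :: "'c topology"
  assumes real: "\<And>T' :: real topology. hereditarily_Lindelof_Tychonoff T' \<Longrightarrow>
      ultrafilter_Menger_space U T' \<Longrightarrow> Menger_space (prod_topology X T')"
    and T: "hereditarily_Lindelof_Tychonoff T" "ultrafilter_Menger_space U T"
  shows "Menger_space (prod_topology X T)"
proof -
  have T': "Hausdorff_space T" "completely_regular_space T" "infinite (topspace T)"
    "hereditarily Lindelof_space T"
    using T(1) unfolding hereditarily_Lindelof_Tychonoff_def infinite_Tychonoff_space_def by auto
  obtain f :: "'c \<Rightarrow> real" where "inj_on f (topspace T)"
    using Hausdorff_hereditarily_Lindelof_inj_real[OF T'(1,4)] by blast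
  then obtain R g where fg: "homeomorphic_maps T R f g"
    using exists_homeomorphic_real_topology by blast
  then have sp: "T homeomorphic_space R" by (auto simp: homeomorphic_space_def)
  have hm: "homeomorphic_map T R f" "homeomorphic_map R T g"
    using fg by (auto simp: homeomorphic_maps_map)
  have f: "continuous_map T R f" "f ` topspace T = topspace R" "inj_on f (topspace T)"
    using homeomorphic_imp_continuous_map[OF hm(1)] homeomorphic_imp_surjective_map[OF hm(1)]
      homeomorphic_imp_injective_map[OF hm(1)] by simp_all
  have g: "continuous_map R T g" "g ` topspace R = topspace T"
    using homeomorphic_imp_continuous_map[OF hm(2)] homeomorphic_imp_surjective_map[OF hm(2)]
    by simp_all
  have "infinite (topspace R)" using f(2,3) T'(3) by (metis finite_image_iff)
  moreover have "completely_regular_space R" "Hausdorff_space R"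
    using T' sp homeomorphic_completely_regular_space homeomorphic_Hausdorff_space by blast+
  moreover have "hereditarily Lindelof_space R"
    using hereditarily_Lindelof_continuous_image[OF T'(4) f(1,2)] .
  ultimately have "Menger_space (prod_topology X R)"
    using ultrafilter_Menger_space_continuous_image[OF T(2) f(1,2)]
    by (intro real) (auto simp: hereditarily_Lindelof_Tychonoff_def infinite_Tychonoff_space_def)
  moreover have "continuous_map (prod_topology X R) (prod_topology X T) (\<lambda>(x, t). (x, g t))"
    using g(1) by (auto simp: continuous_map_prod_top)
  moreover have "(\<lambda>(x, t). (x, g t)) ` topspace (prod_topology X R) = topspace (prod_topology X T)"
    by (simp add: image_paired_Times flip: g(2))
  ultimately show ?thesis by (rule Menger_space_continuous_image)
qed

section \<open>Relations between the covering properties\<close>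

lemma free_ultrafilter_le_sequentially:
  assumes "free_ultrafilter U"
  shows "U \<le> sequentially"
proof (rule filter_leI)
  fix P assume P: "eventually P sequentially"
  have "finite {n. \<not> P n}"
    using P by (simp add: eventually_cofinite flip: cofinite_eq_sequentially)
  then have "\<not> eventually (\<lambda>n. \<not> P n) U"
    using assms unfolding free_ultrafilter_def by blast
  then show "eventually P U"
    using assms unfolding free_ultrafilter_def by blast
qed

lemma Hurewicz_imp_ultrafilter_Menger:
  assumes "Hurewicz_space X" "free_ultrafilter U"
  shows "ultrafilter_Menger_space U X"
  unfolding ultrafilter_Menger_space_def
proof (intro allI impI)
  fix \<U> :: "nat \<Rightarrow> 'a set set" assume "\<forall>n. open_cover X (\<U> n)"
  from assms(1)[unfolded Hurewicz_space_def, THEN spec, THEN mp, OF this]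
  obtain \<F> where "\<forall>n. finite (\<F> n) \<and> \<F> n \<subseteq> \<U> n"
    "\<forall>x\<in>topspace X. \<forall>\<^sub>F n in sequentially. x \<in> \<Union>(\<F> n)"
    by (elim exE conjE)
  then show "\<exists>\<F>. (\<forall>n. finite (\<F> n) \<and> \<F> n \<subseteq> \<U> n) \<and>
      (\<forall>x\<in>topspace X. \<forall>\<^sub>F n in U. x \<in> \<Union>(\<F> n))"
    using filter_leD[OF free_ultrafilter_le_sequentially[OF assms(2)]]
    by (intro exI[of _ \<F>]) simp
qed

text \<open>Finitely many members of \<open>U\<close> have an intersection in \<open>U\<close>,
  which is nonempty.\<close>

lemma ultrafilter_Menger_imp_Scheepers:
  assumes X: "ultrafilter_Menger_space U X" and U: "free_ultrafilter U"
  shows "Scheepers_space X"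
  unfolding Scheepers_space_def
proof (intro allI impI)
  fix \<U> :: "nat \<Rightarrow> 'a set set" assume \<U>: "\<forall>n. open_cover X (\<U> n)"
  obtain \<F> where \<F>: "\<And>n. finite (\<F> n)" "\<And>n. \<F> n \<subseteq> \<U> n"
    "\<And>x. x \<in> topspace X \<Longrightarrow> \<forall>\<^sub>F n in U. x \<in> \<Union>(\<F> n)"
    by (rule ultrafilter_Menger_spaceE[of U X \<U>, OF X \<U>[rule_format]]) (rule that; assumption)
  have "\<exists>n. F \<subseteq> \<Union>(\<F> n)" if F: "finite F \<and> F \<subseteq> topspace X" for F
  proof -
    have "\<forall>\<^sub>F n in U. \<forall>x\<in>F. x \<in> \<Union>(\<F> n)"
      using F \<F>(3) by (intro eventually_ball_finite ballI) auto
    moreover have "U \<noteq> bot" using U by (simp add: free_ultrafilter_def)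
    ultimately have "\<exists>n. \<forall>x\<in>F. x \<in> \<Union>(\<F> n)" by (rule eventually_happens'[rotated])
    then show ?thesis by (auto simp only: subset_iff)
  qed
  then show "\<exists>\<F>. (\<forall>n. finite (\<F> n) \<and> \<F> n \<subseteq> \<U> n) \<and>
      (\<forall>F. finite F \<and> F \<subseteq> topspace X \<longrightarrow> (\<exists>n. F \<subseteq> \<Union>(\<F> n)))"
    using \<F>(1,2) by (intro exI[of _ \<F>]) simp
qed

lemma Scheepers_imp_Menger:
  assumes "Scheepers_space X"
  shows "Menger_space X"
proof (rule Menger_spaceI)
  fix \<U> :: "nat \<Rightarrow> 'a set set" assume "\<And>n. open_cover X (\<U> n)"
  then have "\<forall>n. open_cover X (\<U> n)" ..
  from assms[unfolded Scheepers_space_def, THEN spec, THEN mp, OF this]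
  obtain \<F> where \<F>: "\<forall>n. finite (\<F> n) \<and> \<F> n \<subseteq> \<U> n"
    "\<forall>F. finite F \<and> F \<subseteq> topspace X \<longrightarrow> (\<exists>n. F \<subseteq> \<Union>(\<F> n))"
    by (elim exE conjE)
  have "\<exists>n. x \<in> \<Union>(\<F> n)" if "x \<in> topspace X" for x
    using \<F>(2)[rule_format, of "{x}"] that by simp
  with \<F>(1) show "\<exists>\<F>. (\<forall>n. finite (\<F> n) \<and> \<F> n \<subseteq> \<U> n) \<and> (\<forall>x\<in>topspace X. \<exists>n. x \<in> \<Union>(\<F> n))"
    by (intro exI[of _ \<F>]) simp
qed

section \<open>Selections from covers of Menger and Lindelof spaces\<close>

text \<open>Apply the Menger property to every tail of the sequence and, at \<open>n\<close>, merge
  the contributions of the tails starting at \<open>k \<le> n\<close>. The tail starting at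
  \<open>N\<close> catches each point at some index at least \<open>N\<close>.\<close>

lemma Menger_space_infinitely_often:
  fixes \<U> :: "nat \<Rightarrow> 'a set set"
  assumes X: "Menger_space X" and \<U>: "\<And>n. open_cover X (\<U> n)"
  obtains \<F> where "\<And>n. finite (\<F> n)" "\<And>n. \<F> n \<subseteq> \<U> n"
    "\<And>x N. x \<in> topspace X \<Longrightarrow> \<exists>n\<ge>N. x \<in> \<Union>(\<F> n)"
proof -
  have "\<exists>\<F>. \<forall>n. finite (\<F> n) \<and> \<F> n \<subseteq> \<U> (n + k) \<and>
      (\<forall>x\<in>topspace X. \<exists>n. x \<in> \<Union>(\<F> n))" for k
  proof -
    obtain \<F> where "\<And>n. finite (\<F> n)" "\<And>n. \<F> n \<subseteq> \<U> (n + k)"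
      "\<And>x. x \<in> topspace X \<Longrightarrow> \<exists>n. x \<in> \<Union>(\<F> n)"
      by (rule Menger_spaceE[of X "\<lambda>n. \<U> (n + k)", OF X \<U>]) (rule that; assumption)
    then show ?thesis by (intro exI[of _ \<F>]) simp
  qed
  then have "\<exists>\<F>. \<forall>k n. finite (\<F> k n) \<and> \<F> k n \<subseteq> \<U> (n + k) \<and>
      (\<forall>x\<in>topspace X. \<exists>n. x \<in> \<Union>(\<F> k n))"
    by (intro choice allI)
  then obtain \<F> where sel: "\<forall>k n. finite (\<F> k n) \<and> \<F> k n \<subseteq> \<U> (n + k) \<and>
      (\<forall>x\<in>topspace X. \<exists>n. x \<in> \<Union>(\<F> k n))" ..
  then have \<F>: "finite (\<F> k n)" "\<F> k n \<subseteq> \<U> (n + k)" for k n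
    by simp_all
  have hit: "\<exists>n. x \<in> \<Union>(\<F> k n)" if "x \<in> topspace X" for k x
    using sel that by blast
  define \<G> where "\<G> n = (\<Union>k\<le>n. \<F> k (n - k))" for n
  show ?thesis
  proof
    show "finite (\<G> n)" for n using \<F>(1) by (simp add: \<G>_def)
    show "\<G> n \<subseteq> \<U> n" for n
    proof -
      have "\<F> k (n - k) \<subseteq> \<U> n" if "k \<le> n" for k
        using \<F>(2)[of k "n - k"] that by simp
      then show ?thesis unfolding \<G>_def by (intro UN_least) simp
    qed
    show "\<exists>n\<ge>N. x \<in> \<Union>(\<G> n)" if x: "x \<in> topspace X" for x N
    proof -
      obtain n where n: "x \<in> \<Union>(\<F> N n)" using hit[OF x, of N] by (elim exE)
      have "\<F> N n \<subseteq> \<G> (n + N)" unfolding \<G>_def by (intro subset_trans[OF _ UN_upper[of N]]) simp_all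
      with n have "x \<in> \<Union>(\<G> (n + N))" by auto
      then show ?thesis by (intro exI[of _ "n + N"]) simp
    qed
  qed
qed

lemma Menger_imp_Lindelof:
  assumes "Menger_space X"
  shows "Lindelof_space X"
  unfolding Lindelof_space_def
proof (intro allI impI)
  fix \<U> assume \<U>: "(\<forall>U\<in>\<U>. openin X U) \<and> \<Union>\<U> = topspace X"
  then have "open_cover X \<U>" by (simp add: open_cover_def)
  then obtain \<F> :: "nat \<Rightarrow> 'a set set" where \<F>: "\<And>n. finite (\<F> n)" "\<And>n. \<F> n \<subseteq> \<U>"
      "\<And>x. x \<in> topspace X \<Longrightarrow> \<exists>n. x \<in> \<Union>(\<F> n)"
    by (rule Menger_spaceE[of X "\<lambda>n. \<U>", OF assms]) (rule that; assumption)
  have "countable (\<Union>n. \<F> n)" using \<F>(1) by (simp add: countable_finite)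
  moreover have sub: "(\<Union>n. \<F> n) \<subseteq> \<U>" using \<F>(2) by (rule UN_least)
  moreover have "\<Union>(\<Union>n. \<F> n) = topspace X"
  proof
    show "\<Union>(\<Union>n. \<F> n) \<subseteq> topspace X" using Union_mono[OF sub] \<U> by simp
    show "topspace X \<subseteq> \<Union>(\<Union>n. \<F> n)" using \<F>(3) by auto
  qed
  ultimately show "\<exists>\<V>. countable \<V> \<and> \<V> \<subseteq> \<U> \<and> \<Union>\<V> = topspace X"
    by (intro exI[of _ "\<Union>n. \<F> n"]) simp
qed

text \<open>
  After enumerating a countable subcover of each \<open>\<U> i\<close>, \<open>s z n\<close> is the least \<open>m\<close> such that, for
  all \<open>i \<le> n\<close>, the members number \<open>0\<close> to \<open>m\<close> of the \<open>i\<close>-th subcover catch \<open>z\<close>.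
\<close>

lemma Lindelof_cover_functions:
  fixes \<U> :: "nat \<Rightarrow> 'a set set"
  assumes Z: "Lindelof_space Z" "topspace Z \<noteq> {}" and \<U>: "\<And>n. open_cover Z (\<U> n)"
  obtains s :: "'a \<Rightarrow> nat \<Rightarrow> nat" where "\<And>z. z \<in> topspace Z \<Longrightarrow> mono (s z)"
    "\<And>n m. openin Z {z \<in> topspace Z. s z n \<le> m}"
    "\<And>g. \<exists>\<F>. (\<forall>n. finite (\<F> n) \<and> \<F> n \<subseteq> \<U> n) \<and>
      (\<forall>z\<in>topspace Z. s z \<le>\<^sup>* g \<longrightarrow> (\<forall>\<^sub>F n in sequentially. z \<in> \<Union>(\<F> n)))"
proof -
  have "\<exists>c. (\<forall>k :: nat. c k \<in> \<U> n) \<and> (\<forall>z\<in>topspace Z. \<exists>k. z \<in> c k)" for n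
  proof -
    have "\<exists>\<V>. countable \<V> \<and> \<V> \<subseteq> \<U> n \<and> \<Union>\<V> = topspace Z"
      using \<U>[of n] by (intro Lindelof_spaceD[OF Z(1)]) (auto simp: open_cover_def)
    then obtain \<V> where \<V>: "countable \<V>" "\<V> \<subseteq> \<U> n" "\<Union>\<V> = topspace Z" by (elim exE conjE)
    have "\<V> \<noteq> {}"
    proof
      assume "\<V> = {}"
      with \<V>(3) have "topspace Z = {}" by (simp only: Union_empty)
      with Z(2) show False by contradiction
    qed
    then have range: "range (from_nat_into \<V>) = \<V>" using \<V>(1) range_from_nat_into by metis
    then have "from_nat_into \<V> k \<in> \<U> n" for k using \<V>(2) by auto
    moreover have "\<exists>k. z \<in> from_nat_into \<V> k" if "z \<in> topspace Z" for z
    proof -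
      have "z \<in> \<Union>(range (from_nat_into \<V>))" using that \<V>(3) range by simp
      then show ?thesis by simp
    qed
    ultimately show ?thesis by (intro exI[of _ "from_nat_into \<V>"]) simp
  qed
  then have "\<exists>c. \<forall>n. (\<forall>k :: nat. c n k \<in> \<U> n) \<and> (\<forall>z\<in>topspace Z. \<exists>k. z \<in> c n k)"
    by (intro choice allI)
  then obtain c where sel: "\<forall>n. (\<forall>k :: nat. c n k \<in> \<U> n) \<and> (\<forall>z\<in>topspace Z. \<exists>k. z \<in> c n k)" ..
  then have c: "c n k \<in> \<U> n" "z \<in> topspace Z \<Longrightarrow> \<exists>k. z \<in> c n k" for n k z
    by simp_all
  define s where "s z n = (LEAST m. \<forall>i\<le>n. \<exists>k\<le>m. z \<in> c i k)" for z n
  have ex: "\<exists>m. \<forall>i\<le>n. \<exists>k\<le>m. z \<in> c i k" if z: "z \<in> topspace Z" for z n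
  proof (induction n)
    case 0
    then show ?case using c(2)[OF z, of 0] by (auto simp: Bex_def)
  next
    case (Suc n)
    then obtain m where m: "\<forall>i\<le>n. \<exists>k\<le>m. z \<in> c i k" by auto
    obtain k where "z \<in> c (Suc n) k" using c(2)[OF z] by auto
    then have "\<forall>i\<le>Suc n. \<exists>k'\<le>max m k. z \<in> c i k'"
      using m by (auto simp: le_Suc_eq le_max_iff_disj)
    then show ?case ..
  qed
  have s: "s z n \<le> m \<longleftrightarrow> (\<forall>i\<le>n. \<exists>k\<le>m. z \<in> c i k)" if "z \<in> topspace Z" for z n m
  proof
    assume le: "s z n \<le> m"
    have "\<forall>i\<le>n. \<exists>k\<le>s z n. z \<in> c i k" unfolding s_def by (rule LeastI_ex[OF ex[OF that]])
    with le show "\<forall>i\<le>n. \<exists>k\<le>m. z \<in> c i k" using order_trans by blast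
  next
    show "\<forall>i\<le>n. \<exists>k\<le>m. z \<in> c i k \<Longrightarrow> s z n \<le> m" unfolding s_def by (rule Least_le)
  qed
  show ?thesis
  proof (rule that)
    show "mono (s z)" if z: "z \<in> topspace Z" for z
    proof (rule monoI)
      fix a b :: nat assume "a \<le> b"
      moreover have "\<forall>i\<le>b. \<exists>k\<le>s z b. z \<in> c i k"
        using s[OF z, of b "s z b"] by blast
      ultimately show "s z a \<le> s z b"
        unfolding s[OF z] by (intro allI impI) (erule allE, erule impE, erule (1) order_trans)
    qed
    show "openin Z {z \<in> topspace Z. s z n \<le> m}" for n m
    proof -
      have "{z \<in> topspace Z. s z n \<le> m} = topspace Z \<inter> (\<Inter>i\<in>{..n}. \<Union>k\<in>{..m}. c i k)"
        using s by (auto simp: Bex_def)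
      moreover have "openin Z (c i k)" for i k
        using \<U>[of i] c(1)[of i k] by (simp add: open_cover_def)
      ultimately show ?thesis
        by (auto intro!: openin_Inter openin_clauses)
    qed
    show "\<exists>\<F>. (\<forall>n. finite (\<F> n) \<and> \<F> n \<subseteq> \<U> n) \<and>
      (\<forall>z\<in>topspace Z. s z \<le>\<^sup>* g \<longrightarrow> (\<forall>\<^sub>F n in sequentially. z \<in> \<Union>(\<F> n)))" for g
    proof (intro exI conjI allI ballI impI)
      \<comment> \<open>Members number 0 to \<open>g n\<close> of the \<open>n\<close>-th subcover
        are selected; \<open>s z n \<le> g n\<close> says in particular that one of them contains
        \<open>z\<close>.\<close>
      show "finite (c n ` {..g n})" "c n ` {..g n} \<subseteq> \<U> n" for n
        using c(1) by auto
      show "\<forall>\<^sub>F n in sequentially. z \<in> \<Union>(c n ` {..g n})" if z: "z \<in> topspace Z" "s z \<le>\<^sup>* g" for z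
        using z(2) unfolding eventually_dominated_def
        by (rule eventually_mono) (use s[OF z(1)] in auto)
    qed
  qed
qed

text \<open>The functions belong to a sequence of covers that witnesses the failure: a common bound
  for them would give a Hurewicz selection.\<close>

lemma Lindelof_not_Hurewicz:
  fixes Z :: "'a topology"
  assumes "Lindelof_space Z" "\<not> Hurewicz_space Z" "topspace Z \<noteq> {}"
  obtains s :: "'a \<Rightarrow> nat \<Rightarrow> nat" where "\<And>z. z \<in> topspace Z \<Longrightarrow> mono (s z)"
    "\<And>n m. openin Z {z \<in> topspace Z. s z n \<le> m}" "unbounded_family (s ` topspace Z)"
proof -
  obtain \<U> :: "nat \<Rightarrow> 'a set set" where \<U>: "\<And>n. open_cover Z (\<U> n)"
    "\<not> (\<exists>\<F>. (\<forall>n. finite (\<F> n) \<and> \<F> n \<subseteq> \<U> n) \<and>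
           (\<forall>x\<in>topspace Z. \<forall>\<^sub>F n in sequentially. x \<in> \<Union>(\<F> n)))"
    using assms(2) unfolding Hurewicz_space_def by auto
  obtain s :: "'a \<Rightarrow> nat \<Rightarrow> nat" where s: "\<And>z. z \<in> topspace Z \<Longrightarrow> mono (s z)"
    "\<And>n m. openin Z {z \<in> topspace Z. s z n \<le> m}"
    "\<And>g. \<exists>\<F>. (\<forall>n. finite (\<F> n) \<and> \<F> n \<subseteq> \<U> n) \<and>
      (\<forall>z\<in>topspace Z. s z \<le>\<^sup>* g \<longrightarrow> (\<forall>\<^sub>F n in sequentially. z \<in> \<Union>(\<F> n)))"
    by (rule Lindelof_cover_functions[of Z \<U>, OF assms(1,3) \<U>(1)]) (rule that; assumption)
  have "unbounded_family (s ` topspace Z)"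
    unfolding unbounded_family_def
  proof
    assume "\<exists>g. \<forall>f\<in>s ` topspace Z. f \<le>\<^sup>* g"
    then obtain g where g: "\<And>z. z \<in> topspace Z \<Longrightarrow> s z \<le>\<^sup>* g" by auto
    from s(3)[of g] \<U>(2) g show False by auto
  qed
  with s(1,2) show ?thesis by (rule that)
qed

text \<open>The functions that code the covers at fewer than \<bb> points have a common bound, and
  this bound gives a selection.\<close>

lemma small_subset_selection:
  fixes \<U> :: "nat \<Rightarrow> 'a set set" and t :: "'i \<Rightarrow> 'a"
  assumes "Lindelof_space Z" "topspace Z \<noteq> {}" "\<And>n. open_cover Z (\<U> n)"
    and "|I| <o \<bb>" "t ` I \<subseteq> topspace Z"
  obtains \<F> where "\<And>n. finite (\<F> n)" "\<And>n. \<F> n \<subseteq> \<U> n"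
    "\<And>i. i \<in> I \<Longrightarrow> \<forall>\<^sub>F n in sequentially. t i \<in> \<Union>(\<F> n)"
proof -
  obtain s :: "'a \<Rightarrow> nat \<Rightarrow> nat" where s: 
    "\<And>g. \<exists>\<F>. (\<forall>n. finite (\<F> n) \<and> \<F> n \<subseteq> \<U> n) \<and>
      (\<forall>z\<in>topspace Z. s z \<le>\<^sup>* g \<longrightarrow> (\<forall>\<^sub>F n in sequentially. z \<in> \<Union>(\<F> n)))"
    by (rule Lindelof_cover_functions[of Z \<U>, OF assms(1-3)]) (rule that; assumption)
  obtain g where g: "\<forall>i\<in>I. s (t i) \<le>\<^sup>* g"
    using bounded_if_less_bounding_number[OF assms(4), of "\<lambda>i. s (t i)"] ..
  obtain \<F> where \<F>: "\<forall>n. finite (\<F> n) \<and> \<F> n \<subseteq> \<U> n"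
    "\<forall>z\<in>topspace Z. s z \<le>\<^sup>* g \<longrightarrow> (\<forall>\<^sub>F n in sequentially. z \<in> \<Union>(\<F> n))"
    using s[of g] by (elim exE conjE)
  show ?thesis
    using \<F> g assms(5) by (intro that[of \<F>]) (auto simp only: image_subset_iff)
qed

section \<open>Subspaces of products with the Cantor space\<close>

text \<open>Points are characteristic functions, so this is the power set of \<omega> with its usual
  topology.\<close>

definition Cantor_space :: "(nat \<Rightarrow> bool) topology"
  where "Cantor_space = product_topology (\<lambda>_. discrete_topology UNIV) UNIV"

lemma topspace_Cantor_space [simp]: "topspace Cantor_space = UNIV"
  by (simp add: Cantor_space_def)

lemma completely_regular_Cantor_space: "completely_regular_space Cantor_space"
  unfolding Cantor_space_def completely_regular_space_product_topology
  by (simp add: metrizable_imp_completely_regular_space)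

lemma Hausdorff_Cantor_space: "Hausdorff_space Cantor_space"
  unfolding Cantor_space_def Hausdorff_space_product_topology by simp

lemma openin_Cantor_coordinate: "openin Cantor_space {b. b k}"
proof -
  have "continuous_map Cantor_space (discrete_topology UNIV) (\<lambda>b. b k)"
    unfolding Cantor_space_def by (rule continuous_map_product_projection) simp
  then have "openin Cantor_space {b \<in> topspace Cantor_space. b k \<in> {True}}"
    by (rule openin_continuous_map_preimage) simp
  then show ?thesis by simp
qed

lemma openin_Cantor_cylinder:
  assumes "openin Cantor_space W" "b \<in> W"
  obtains l :: nat where "\<And>b'. (\<forall>k<l. b' k = b k) \<Longrightarrow> b' \<in> W"
proof -
  obtain U where U: "finite {i. U i \<noteq> UNIV}" "b \<in> Pi\<^sub>E UNIV U" "Pi\<^sub>E UNIV U \<subseteq> W"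
    using assms unfolding Cantor_space_def openin_product_topology_alt by auto
  obtain l where l: "{i. U i \<noteq> UNIV} \<subseteq> {..<l}"
    using U(1) finite_nat_iff_bounded by blast
  have "b' \<in> W" if b': "\<forall>k<l. b' k = b k" for b'
  proof -
    have "b' i \<in> U i" for i
    proof (cases "i < l")
      case True
      then show ?thesis using b' U(2) by (auto simp: PiE_def Pi_def)
    next
      case False
      then have "U i = UNIV" using l by auto
      then show ?thesis by simp
    qed
    then show ?thesis using U(3) by (auto simp: PiE_def Pi_def)
  qed
  then show ?thesis by (rule that)
qed

lemma openin_prod_Cantor:
  assumes "openin (prod_topology Y Cantor_space) W" "(y, b) \<in> W"
  obtains V and l :: nat where "openin Y V" "y \<in> V"
    "\<And>v b'. v \<in> V \<Longrightarrow> (\<forall>k<l. b' k = b k) \<Longrightarrow> (v, b') \<in> W"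
proof -
  obtain V W' where V: "openin Y V" "openin Cantor_space W'" "y \<in> V" "b \<in> W'" "V \<times> W' \<subseteq> W"
    using assms unfolding openin_prod_topology_alt by meson
  obtain l where "\<And>b'. (\<forall>k<l. b' k = b k) \<Longrightarrow> b' \<in> W'"
    by (rule openin_Cantor_cylinder[OF V(2,4)]) (rule that)
  with V show ?thesis by (intro that[of V l]) auto
qed

lemma hereditarily_Lindelof_countable_subfamily:
  assumes "hereditarily Lindelof_space Y" "\<And>V. V \<in> \<V> \<Longrightarrow> openin Y V"
  obtains \<V>' where "countable \<V>'" "\<V>' \<subseteq> \<V>" "\<Union>\<V>' = \<Union>\<V>"
proof -
  have "\<Union>\<V> \<subseteq> topspace Y" using assms(2) openin_subset by blast
  moreover have "Lindelof_space (subtopology Y (\<Union>\<V>))" using assms(1) by (simp add: hereditarily)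
  ultimately have "\<exists>\<V>'. countable \<V>' \<and> \<V>' \<subseteq> \<V> \<and> \<Union>\<V> \<subseteq> \<Union>\<V>'"
    using assms(2) by (simp add: Lindelof_space_subtopology_subset)
  then obtain \<V>' where \<V>': "countable \<V>'" "\<V>' \<subseteq> \<V>" "\<Union>\<V> \<subseteq> \<Union>\<V>'" by (elim exE conjE)
  then show ?thesis using Union_mono[OF \<V>'(2)] by (intro that[of \<V>']) auto
qed

text \<open>Cylinders of finite binary words form a countable base of the second factor. For each
  word, countably many open sets of \<open>Y\<close> suffice, because \<open>Y\<close> is
  hereditarily Lindelof.\<close>

lemma hereditarily_Lindelof_prod_Cantor:
  assumes Y: "hereditarily Lindelof_space Y"
  shows "hereditarily Lindelof_space (prod_topology Y Cantor_space)"
  unfolding hereditarily_def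
proof (intro allI impI)
  let ?P = "prod_topology Y Cantor_space"
  let ?restr = "\<lambda>b l. map b [0..<l]"
  fix S assume S: "S \<subseteq> topspace ?P"
  have "\<exists>\<V>. countable \<V> \<and> \<V> \<subseteq> \<W> \<and> S \<subseteq> \<Union>\<V>"
    if \<W>: "\<forall>W\<in>\<W>. openin ?P W" "S \<subseteq> \<Union>\<W>" for \<W>
  proof -
    \<comment> \<open>These are the open \<open>V\<close> whose product with the cylinder of
      \<sigma> lies in a single member of the cover.\<close>
    define \<V> where "\<V> \<sigma> = {V. openin Y V \<and>
      (\<exists>W\<in>\<W>. \<forall>v\<in>V. \<forall>b. ?restr b (length \<sigma>) = \<sigma> \<longrightarrow> (v, b) \<in> W)}" for \<sigma> :: "bool list"
    have "\<exists>\<V>'. countable \<V>' \<and> \<V>' \<subseteq> \<V> \<sigma> \<and> \<Union>\<V>' = \<Union>(\<V> \<sigma>)" for \<sigma>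
    proof -
      obtain \<V>' where "countable \<V>'" "\<V>' \<subseteq> \<V> \<sigma>" "\<Union>\<V>' = \<Union>(\<V> \<sigma>)"
        by (rule hereditarily_Lindelof_countable_subfamily[of Y "\<V> \<sigma>", OF Y]) (auto simp: \<V>_def)
      then show ?thesis by (intro exI[of _ \<V>']) simp
    qed
    then have "\<exists>\<V>'. \<forall>\<sigma>. countable (\<V>' \<sigma>) \<and> \<V>' \<sigma> \<subseteq> \<V> \<sigma> \<and> \<Union>(\<V>' \<sigma>) = \<Union>(\<V> \<sigma>)"
      by (intro choice allI)
    then obtain \<V>' where "\<forall>\<sigma>. countable (\<V>' \<sigma>) \<and> \<V>' \<sigma> \<subseteq> \<V> \<sigma> \<and> \<Union>(\<V>' \<sigma>) = \<Union>(\<V> \<sigma>)" ..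
    then have \<V>': "countable (\<V>' \<sigma>)" "\<V>' \<sigma> \<subseteq> \<V> \<sigma>" "\<Union>(\<V>' \<sigma>) = \<Union>(\<V> \<sigma>)" for \<sigma>
      by simp_all
    define w where "w \<sigma> V = (SOME W. W \<in> \<W> \<and> (\<forall>v\<in>V. \<forall>b. ?restr b (length \<sigma>) = \<sigma> \<longrightarrow> (v, b) \<in> W))" for \<sigma> V
    have w: "w \<sigma> V \<in> \<W> \<and> (\<forall>v\<in>V. \<forall>b. ?restr b (length \<sigma>) = \<sigma> \<longrightarrow> (v, b) \<in> w \<sigma> V)" if "V \<in> \<V> \<sigma>" for \<sigma> V
      unfolding w_def by (rule someI_ex) (use that in \<open>auto simp: \<V>_def\<close>)
    let ?R = "\<Union>\<sigma>. w \<sigma> ` \<V>' \<sigma>"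
    have "countable ?R" using \<V>'(1) by simp
    moreover have "?R \<subseteq> \<W>" using w \<V>'(2) by (auto simp: subset_iff)
    moreover have "S \<subseteq> \<Union>?R"
    proof
      fix z assume z: "z \<in> S"
      obtain y b where yb: "z = (y, b)" by (cases z)
      obtain W where W: "W \<in> \<W>" "(y, b) \<in> W" using z yb \<W>(2) by auto
      then have "openin ?P W" using \<W>(1) by simp
      then obtain V l where V: "openin Y V" "y \<in> V"
        "\<And>v b'. v \<in> V \<Longrightarrow> (\<forall>k<l. b' k = b k) \<Longrightarrow> (v, b') \<in> W"
        by (rule openin_prod_Cantor[OF _ W(2)]) (rule that; assumption)
      have "(v, b') \<in> W" if "v \<in> V" "?restr b' l = ?restr b l" for v b'
        using that V(3) by (auto simp: map_eq_conv)
      then have "V \<in> \<V> (?restr b l)" using V(1) W(1) unfolding \<V>_def by auto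
      then have "y \<in> \<Union>(\<V>' (?restr b l))" using V(2) \<V>'(3) by auto
      then obtain V' where V': "V' \<in> \<V>' (?restr b l)" "y \<in> V'" by auto
      then have "V' \<in> \<V> (?restr b l)" using \<V>'(2) by auto
      from w[OF this] have "z \<in> w (?restr b l) V'" using V'(2) yb by auto
      then show "z \<in> \<Union>?R" using V'(1) by auto
    qed
    ultimately show ?thesis by (intro exI[of _ ?R]) simp
  qed
  then show "Lindelof_space (subtopology ?P S)"
    by (simp only: Lindelof_space_subtopology_subset[OF S]) simp
qed

lemma hereditarily_Lindelof_Tychonoff_subspace:
  assumes Y: "hereditarily_Lindelof_Tychonoff Y" and E: "infinite E" "E \<subseteq> topspace Y \<times> UNIV"
  shows "hereditarily_Lindelof_Tychonoff (subtopology (prod_topology Y Cantor_space) E)"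
proof -
  have Y': "completely_regular_space Y" "Hausdorff_space Y" "hereditarily Lindelof_space Y"
    using Y by (auto simp: hereditarily_Lindelof_Tychonoff_def infinite_Tychonoff_space_def)
  have "completely_regular_space (prod_topology Y Cantor_space)"
    using Y'(1) completely_regular_Cantor_space by (simp add: completely_regular_space_prod_topology)
  then have "completely_regular_space (subtopology (prod_topology Y Cantor_space) E)"
    by (rule completely_regular_space_subtopology)
  moreover have "Hausdorff_space (prod_topology Y Cantor_space)"
    using Y'(2) Hausdorff_Cantor_space by (simp add: Hausdorff_space_prod_topology)
  then have "Hausdorff_space (subtopology (prod_topology Y Cantor_space) E)"
    by (rule Hausdorff_space_subtopology)
  moreover have "hereditarily Lindelof_space (subtopology (prod_topology Y Cantor_space) E)"
    using hereditarily_Lindelof_prod_Cantor[OF Y'(3)] by (simp add: hereditarily subtopology_subtopology)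
  moreover have "topspace (subtopology (prod_topology Y Cantor_space) E) = E"
    using E(2) by (simp add: Int_absorb1)
  ultimately show ?thesis
    using E(1) by (simp add: hereditarily_Lindelof_Tychonoff_def infinite_Tychonoff_space_def)
qed

section \<open>Spaces over \<open>Y\<close> that contain all points with cofinite second
  coordinate\<close>

lemma finite_eventually_True_after: "finite {b :: nat \<Rightarrow> bool. \<forall>k\<ge>n. b k}"
proof (rule finite_subset)
  show "{b :: nat \<Rightarrow> bool. \<forall>k\<ge>n. b k} \<subseteq> (\<lambda>A k. k \<in> A \<or> n \<le> k) ` Pow {..<n}"
  proof
    fix b :: "nat \<Rightarrow> bool" assume "b \<in> {b. \<forall>k\<ge>n. b k}"
    then have "b = (\<lambda>k. k \<in> {k. k < n \<and> b k} \<or> n \<le> k)" by (auto simp: fun_eq_iff not_less)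
    then show "b \<in> (\<lambda>A k. k \<in> A \<or> n \<le> k) ` Pow {..<n}" by (rule image_eqI) auto
  qed
qed simp

text \<open>Covering arguments near the points with cofinite second coordinate work whatever further
  points \<open>E\<close> has, so those are left open here.\<close>

locale cofinite_subspace =
  fixes Y :: "'c topology" and E :: "('c \<times> (nat \<Rightarrow> bool)) set"
  assumes E_sub: "E \<subseteq> topspace Y \<times> UNIV"
    and E_cofinite: "\<And>y b n. y \<in> topspace Y \<Longrightarrow> (\<forall>k\<ge>n. b k) \<Longrightarrow> (y, b) \<in> E"
begin

abbreviation T :: "('c \<times> (nat \<Rightarrow> bool)) topology"
  where "T \<equiv> subtopology (prod_topology Y Cantor_space) E"

lemma topspace_T: "topspace T = E"
  using E_sub by (simp add: Int_absorb1)

text \<open>\<open>F\<close> has to deal with every \<open>b\<close> that contains the interval from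
  \<open>n\<close> to \<open>l - 1\<close>, no matter what \<open>b\<close> is below
  \<open>n\<close> and from \<open>l\<close> on.\<close>

definition caught :: "nat \<Rightarrow> 'c set \<Rightarrow> nat \<Rightarrow> ('c \<times> (nat \<Rightarrow> bool)) set set \<Rightarrow> bool"
  where "caught n V l F \<longleftrightarrow> (\<forall>v\<in>V. \<forall>b. (v, b) \<in> E \<and> (\<forall>k. n \<le> k \<and> k < l \<longrightarrow> b k) \<longrightarrow> (v, b) \<in> \<Union>F)"

text \<open>Only finitely many \<open>b\<close> are true from \<open>n\<close> on. Basic
  neighbourhoods of the points \<open>(y, b)\<close> with such \<open>b\<close> yield one
  \<open>V\<close>, one length and one finite \<open>F\<close>.\<close>

lemma exists_caught_neighbourhood:
  assumes \<U>: "open_cover T \<U>" and y: "y \<in> topspace Y"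
  shows "\<exists>V l F. openin Y V \<and> y \<in> V \<and> finite F \<and> F \<subseteq> \<U> \<and> caught n V l F"
proof -
  let ?B = "{b :: nat \<Rightarrow> bool. \<forall>k\<ge>n. b k}"
  have "\<forall>b\<in>?B. \<exists>V l W. openin Y V \<and> y \<in> V \<and> W \<in> \<U> \<and>
      (\<forall>v\<in>V. \<forall>b'. (\<forall>k<l. b' k = b k) \<and> (v, b') \<in> E \<longrightarrow> (v, b') \<in> W)"
  proof
    fix b assume "b \<in> ?B"
    then have "(y, b) \<in> E" using E_cofinite[OF y] by simp
    then have "(y, b) \<in> \<Union>\<U>" using \<U> unfolding open_cover_def topspace_T by simp
    then obtain W where W: "W \<in> \<U>" "(y, b) \<in> W" by auto
    then have "openin T W" using \<U> by (simp add: open_cover_def)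
    then obtain W' where W': "openin (prod_topology Y Cantor_space) W'" "W = W' \<inter> E"
      by (auto simp: openin_subtopology)
    have "(y, b) \<in> W'" using W(2) W'(2) by simp
    with W'(1) obtain V l where V: "openin Y V" "y \<in> V"
      "\<And>v b'. v \<in> V \<Longrightarrow> (\<forall>k<l. b' k = b k) \<Longrightarrow> (v, b') \<in> W'"
      by (rule openin_prod_Cantor) (rule that; assumption)
    then show "\<exists>V l W. openin Y V \<and> y \<in> V \<and> W \<in> \<U> \<and>
      (\<forall>v\<in>V. \<forall>b'. (\<forall>k<l. b' k = b k) \<and> (v, b') \<in> E \<longrightarrow> (v, b') \<in> W)"
      using W(1) W'(2) by (intro exI[of _ V] exI[of _ l] exI[of _ W]) simp
  qed
  then obtain V l W where VlW: "\<forall>b\<in>?B. openin Y (V b) \<and> y \<in> V b \<and> W b \<in> \<U> \<and>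
      (\<forall>v\<in>V b. \<forall>b'. (\<forall>k<l b. b' k = b k) \<and> (v, b') \<in> E \<longrightarrow> (v, b') \<in> W b)"
    by (simp only: bchoice_iff) (elim exE)
  have fin: "finite ?B" by (rule finite_eventually_True_after)
  let ?V = "topspace Y \<inter> (\<Inter>b\<in>?B. V b)"
  have ne: "?B \<noteq> {}" by auto
  have "caught n ?V (\<Sum>b\<in>?B. l b) (W ` ?B)"
    unfolding caught_def
  proof (intro ballI allI impI)
    fix v b assume v: "v \<in> ?V" and b: "(v, b) \<in> E \<and> (\<forall>k. n \<le> k \<and> k < (\<Sum>b\<in>?B. l b) \<longrightarrow> b k)"
    \<comment> \<open>Filling up \<open>b\<close> from \<open>n\<close> on gives a member of
      \<open>?B\<close>. The two agree below \<open>l ?b\<close>, since the sum of all lengths is at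
      least \<open>l ?b\<close>.\<close>
    let ?b = "\<lambda>k. b k \<or> n \<le> k"
    have B: "?b \<in> ?B" by simp
    then have "l ?b \<le> (\<Sum>b\<in>?B. l b)" using fin by (intro member_le_sum) auto
    then have "\<forall>k<l ?b. b k = ?b k" using b by (auto simp: not_le)
    moreover have "v \<in> V ?b" using v B by blast
    ultimately have "(v, b) \<in> W ?b" using VlW[rule_format, OF B] b by blast
    then show "(v, b) \<in> \<Union>(W ` ?B)" by (rule UN_I[OF B])
  qed
  moreover have "openin Y ?V"
    using fin ne VlW by (intro openin_Int openin_topspace openin_INT2) auto
  moreover have "y \<in> ?V" using VlW y by simp
  moreover have "W ` ?B \<subseteq> \<U>" using VlW by (simp add: image_subset_iff)
  moreover have "finite (W ` ?B)" using fin by (rule finite_imageI)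
  ultimately show ?thesis by (intro exI conjI)
qed

text \<open>The sum serves as a common upper bound of the lengths; a longer interval only asks more
  of \<open>b\<close>.\<close>

lemma caught_union:
  assumes "\<And>V. V \<in> \<G> \<Longrightarrow> caught n V (l V) (F V)" "finite \<G>"
  shows "caught n (\<Union>\<G>) (\<Sum>V\<in>\<G>. l V) (\<Union>V\<in>\<G>. F V)"
  unfolding caught_def
proof (intro ballI allI impI)
  fix v b assume "v \<in> \<Union>\<G>" and b: "(v, b) \<in> E \<and> (\<forall>k. n \<le> k \<and> k < (\<Sum>V\<in>\<G>. l V) \<longrightarrow> b k)"
  then obtain V where V: "V \<in> \<G>" "v \<in> V" by auto
  have "l V \<le> (\<Sum>V\<in>\<G>. l V)" using V(1) assms(2) by (intro member_le_sum) auto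
  then have "(v, b) \<in> E \<and> (\<forall>k. n \<le> k \<and> k < l V \<longrightarrow> b k)" using b by auto
  then have "(v, b) \<in> \<Union>(F V)" using assms(1)[OF V(1)] V(2) unfolding caught_def by simp
  then show "(v, b) \<in> \<Union>(\<Union>V\<in>\<G>. F V)" using V(1) by auto
qed

text \<open>The Hurewicz property of \<open>Y\<close> is applied to the covers by open sets that are
  caught from \<open>n\<close> on by finitely many members of \<open>\<U> n\<close>.
  \<open>g n\<close> is a common interval end for the finitely many sets selected at
  \<open>n\<close>.\<close>

lemma Hurewicz_tail_selection:
  fixes \<U> :: "nat \<Rightarrow> ('c \<times> (nat \<Rightarrow> bool)) set set"
  assumes Y: "Hurewicz_space Y" and \<U>: "\<And>n. open_cover T (\<U> n)"
  obtains \<F> g where "\<And>n. finite (\<F> n)" "\<And>n. \<F> n \<subseteq> \<U> n"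
    "\<And>v b. (v, b) \<in> E \<Longrightarrow>
      \<forall>\<^sub>F n in sequentially. (\<forall>k. n \<le> k \<and> k < g n \<longrightarrow> b k) \<longrightarrow> (v, b) \<in> \<Union>(\<F> n)"
proof -
  define \<V> where "\<V> n = {V. openin Y V \<and> (\<exists>l F. finite F \<and> F \<subseteq> \<U> n \<and> caught n V l F)}" for n
  have "open_cover Y (\<V> n)" for n
    unfolding open_cover_def
  proof (intro conjI ballI antisym)
    show "openin Y V" if "V \<in> \<V> n" for V using that by (simp add: \<V>_def)
    then show "\<Union>(\<V> n) \<subseteq> topspace Y" by (intro Union_least openin_subset)
    show "topspace Y \<subseteq> \<Union>(\<V> n)"
    proof
      fix y assume "y \<in> topspace Y"
      from exists_caught_neighbourhood[OF \<U> this, of n n]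
      show "y \<in> \<Union>(\<V> n)" unfolding \<V>_def by blast
    qed
  qed
  then have "\<forall>n. open_cover Y (\<V> n)" ..
  from Y[unfolded Hurewicz_space_def, THEN spec, THEN mp, OF this]
  obtain \<G> where \<G>: "\<forall>n. finite (\<G> n) \<and> \<G> n \<subseteq> \<V> n"
    "\<forall>y\<in>topspace Y. \<forall>\<^sub>F n in sequentially. y \<in> \<Union>(\<G> n)"
    by (elim exE conjE)
  have "\<exists>l F. finite F \<and> F \<subseteq> \<U> n \<and> caught n (\<Union>(\<G> n)) l F" for n
  proof -
    have "\<forall>V\<in>\<G> n. \<exists>l F. finite F \<and> F \<subseteq> \<U> n \<and> caught n V l F"
    proof
      fix V assume "V \<in> \<G> n"
      then have "V \<in> \<V> n" using \<G>(1) by auto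
      then show "\<exists>l F. finite F \<and> F \<subseteq> \<U> n \<and> caught n V l F" by (simp add: \<V>_def)
    qed
    then obtain l F where lF: "\<forall>V\<in>\<G> n. finite (F V) \<and> F V \<subseteq> \<U> n \<and> caught n V (l V) (F V)"
      by (simp only: bchoice_iff) (elim exE)
    then have "caught n (\<Union>(\<G> n)) (\<Sum>V\<in>\<G> n. l V) (\<Union>V\<in>\<G> n. F V)"
      using \<G>(1) by (intro caught_union) simp_all
    moreover have "finite (\<Union>V\<in>\<G> n. F V)" using \<G>(1) lF by (intro finite_UN_I) simp_all
    moreover have "(\<Union>V\<in>\<G> n. F V) \<subseteq> \<U> n" using lF by (intro UN_least) simp
    ultimately show ?thesis by (intro exI conjI) assumption+
  qed
  then have "\<exists>l. \<forall>n. \<exists>F. finite F \<and> F \<subseteq> \<U> n \<and> caught n (\<Union>(\<G> n)) (l n) F"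
    by (intro choice allI)
  then obtain g where "\<forall>n. \<exists>F. finite F \<and> F \<subseteq> \<U> n \<and> caught n (\<Union>(\<G> n)) (g n) F" ..
  then have "\<exists>F. \<forall>n. finite (F n) \<and> F n \<subseteq> \<U> n \<and> caught n (\<Union>(\<G> n)) (g n) (F n)"
    by (intro choice)
  then obtain \<F> where \<F>: "\<forall>n. finite (\<F> n) \<and> \<F> n \<subseteq> \<U> n \<and> caught n (\<Union>(\<G> n)) (g n) (\<F> n)" ..
  show ?thesis
  proof (rule that)
    show "finite (\<F> n)" "\<F> n \<subseteq> \<U> n" for n using \<F> by simp_all
    show "\<forall>\<^sub>F n in sequentially. (\<forall>k. n \<le> k \<and> k < g n \<longrightarrow> b k) \<longrightarrow> (v, b) \<in> \<Union>(\<F> n)"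
      if vb: "(v, b) \<in> E" for v b
    proof -
      have "v \<in> topspace Y" using vb E_sub by auto
      with \<G>(2) have "\<forall>\<^sub>F n in sequentially. v \<in> \<Union>(\<G> n)" ..
      then show ?thesis
      proof (rule eventually_mono)
        fix n assume "v \<in> \<Union>(\<G> n)"
        then show "(\<forall>k. n \<le> k \<and> k < g n \<longrightarrow> b k) \<longrightarrow> (v, b) \<in> \<Union>(\<F> n)"
          using \<F>[rule_format, of n] vb unfolding caught_def by blast
      qed
    qed
  qed
qed

text \<open>
  A selection that serves the points with cofinite second coordinate also serves, for \<open>U\<close>-many
  \<open>n\<close>, all but fewer than \<open>\<bb>\<close> of the points \<open>t i\<close>; those get a selection of their own.
\<close>

lemma ultrafilter_Menger_concentrated:
  fixes t :: "'i \<Rightarrow> 'c \<times> (nat \<Rightarrow> bool)"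
  assumes Y: "Hurewicz_space Y" "topspace Y \<noteq> {}" and T: "Lindelof_space T"
    and U: "free_ultrafilter U"
    and E: "\<And>v b. (v, b) \<in> E \<Longrightarrow> (\<exists>n. \<forall>k\<ge>n. b k) \<or> (\<exists>i\<in>I. t i = (v, b))"
    and t: "t ` I \<subseteq> E"
    and conc: "\<And>g. \<exists>K\<subseteq>I. |K| <o \<bb> \<and> (\<forall>i\<in>I - K. \<forall>\<^sub>F n in U. \<forall>k. n \<le> k \<and> k < g n \<longrightarrow> snd (t i) k)"
  shows "ultrafilter_Menger_space U T"
  unfolding ultrafilter_Menger_space_def
proof (intro allI impI)
  fix \<U> :: "nat \<Rightarrow> ('c \<times> (nat \<Rightarrow> bool)) set set" assume \<U>: "\<forall>n. open_cover T (\<U> n)"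
  have Ule: "U \<le> sequentially" using U by (rule free_ultrafilter_le_sequentially)
  obtain \<F> g where \<F>: "\<And>n. finite (\<F> n)" "\<And>n. \<F> n \<subseteq> \<U> n"
    "\<And>v b. (v, b) \<in> E \<Longrightarrow>
      \<forall>\<^sub>F n in sequentially. (\<forall>k. n \<le> k \<and> k < g n \<longrightarrow> b k) \<longrightarrow> (v, b) \<in> \<Union>(\<F> n)"
    by (rule Hurewicz_tail_selection[of \<U>, OF Y(1) \<U>[rule_format]]) (rule that; assumption)
  obtain K where K: "K \<subseteq> I" "|K| <o \<bb>"
    "\<And>i. i \<in> I - K \<Longrightarrow> \<forall>\<^sub>F n in U. \<forall>k. n \<le> k \<and> k < g n \<longrightarrow> snd (t i) k"
    using conc[of g] by auto
  have ne: "topspace T \<noteq> {}"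
  proof -
    obtain y where "y \<in> topspace Y" using Y(2) by blast
    then have "(y, \<lambda>_. True) \<in> E" using E_cofinite by simp
    then show ?thesis unfolding topspace_T by auto
  qed
  have "t ` K \<subseteq> topspace T" using K(1) t unfolding topspace_T by auto
  then obtain \<G> where \<G>: "\<And>n. finite (\<G> n)" "\<And>n. \<G> n \<subseteq> \<U> n"
    "\<And>i. i \<in> K \<Longrightarrow> \<forall>\<^sub>F n in sequentially. t i \<in> \<Union>(\<G> n)"
    by (rule small_subset_selection[of T \<U> K t, OF T ne \<U>[rule_format] K(2)]) (rule that; assumption)
  have "\<forall>\<^sub>F n in U. z \<in> \<Union>(\<F> n \<union> \<G> n)" if z: "z \<in> E" for z
  proof -
    obtain v b where vb: "z = (v, b)" by (cases z)
    have ev: "\<forall>\<^sub>F n in U. (\<forall>k. n \<le> k \<and> k < g n \<longrightarrow> b k) \<longrightarrow> (v, b) \<in> \<Union>(\<F> n)"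
      using filter_leD[OF Ule \<F>(3)] z vb by simp
    consider N where "\<forall>k\<ge>N. b k" | i where "i \<in> K" "t i = z" | i where "i \<in> I - K" "t i = z"
      using E[of v b] z vb by auto
    then show ?thesis
    proof cases
      case 1
      have "\<forall>\<^sub>F n in U. N \<le> n" using filter_leD[OF Ule eventually_ge_at_top] .
      with ev show ?thesis by eventually_elim (use 1 vb in auto)
    next
      case 2
      have "\<forall>\<^sub>F n in U. z \<in> \<Union>(\<G> n)" using filter_leD[OF Ule \<G>(3)[OF 2(1)]] 2(2) by simp
      then show ?thesis by (rule eventually_mono) auto
    next
      case 3
      have "\<forall>\<^sub>F n in U. \<forall>k. n \<le> k \<and> k < g n \<longrightarrow> b k" using K(3)[OF 3(1)] 3(2) vb by simp
      with ev show ?thesis by eventually_elim (use vb in auto)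
    qed
  qed
  then show "\<exists>\<F>. (\<forall>n. finite (\<F> n) \<and> \<F> n \<subseteq> \<U> n) \<and>
      (\<forall>x\<in>topspace T. \<forall>\<^sub>F n in U. x \<in> \<Union>(\<F> n))"
    using \<F>(1,2) \<G>(1,2) unfolding topspace_T
    by (intro exI[of _ "\<lambda>n. \<F> n \<union> \<G> n"]) simp
qed

end

section \<open>Productivity\<close>

text \<open>
  \<open>min {s z k | k. n \<le> k \<and> b k}\<close>, for infinite \<open>b\<close>, is a function of \<open>n\<close> that depends on
  \<open>(z, b)\<close> semicontinuously, so its values are not dominating on a Menger space.
\<close>

lemma not_Menger_if_dominating:
  fixes X :: "'a topology" and Y :: "'c topology"
  assumes s: "\<And>n m. openin (prod_topology X Y) {z \<in> topspace (prod_topology X Y). s z n \<le> (m :: nat)}"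
    and E: "E \<subseteq> topspace Y \<times> UNIV" "\<And>y b. (y, b) \<in> E \<Longrightarrow> \<exists>\<^sub>\<infinity>k. b k"
    and dom: "\<And>g. \<exists>x y b. x \<in> topspace X \<and> (y, b) \<in> E \<and>
      (\<forall>\<^sub>F n in sequentially. \<forall>k. n \<le> k \<and> b k \<longrightarrow> g n < s (x, y) k)"
  shows "\<not> Menger_space (prod_topology X (subtopology (prod_topology Y Cantor_space) E))"
proof
  let ?P = "prod_topology X (subtopology (prod_topology Y Cantor_space) E)"
  assume M: "Menger_space ?P"
  have top: "topspace ?P = topspace X \<times> E" using E(1) by (simp add: Int_absorb1)
  \<comment> \<open>\<open>W n m\<close> is where the minimum described above is at most
    \<open>m\<close>; each \<open>k\<close> contributes an open condition on \<open>s\<close> and on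
    the \<open>k\<close>-th coordinate.\<close>
  define W where "W n m = (\<Union>k\<in>{n..}. {p \<in> topspace ?P. s (fst p, fst (snd p)) k \<le> m \<and> snd (snd p) k})" for n m
  have W: "(x, (y, b)) \<in> W n m \<longleftrightarrow> x \<in> topspace X \<and> (y, b) \<in> E \<and> (\<exists>k\<ge>n. b k \<and> s (x, y) k \<le> m)" for x y b n m
    unfolding W_def top by auto
  have cm: "continuous_map (subtopology (prod_topology Y Cantor_space) E) Y fst"
    "continuous_map (subtopology (prod_topology Y Cantor_space) E) Cantor_space snd"
    by (simp_all add: continuous_map_from_subtopology continuous_map_fst continuous_map_snd)
  have c1: "continuous_map ?P (prod_topology X Y) (\<lambda>p. (fst p, fst (snd p)))"
    using continuous_map_compose[OF continuous_map_snd cm(1)]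
    by (simp add: continuous_map_pairwise o_def continuous_map_fst)
  have c2: "continuous_map ?P Cantor_space (\<lambda>p. snd (snd p))"
    using continuous_map_compose[OF continuous_map_snd cm(2)] by (simp add: o_def)
  have W_open: "openin ?P (W n m)" for n m
  proof -
    have "openin ?P ({p \<in> topspace ?P. (fst p, fst (snd p)) \<in> {z \<in> topspace (prod_topology X Y). s z k \<le> m}}
        \<inter> {p \<in> topspace ?P. snd (snd p) \<in> {b. b k}})" for k
      by (intro openin_Int openin_continuous_map_preimage[OF c1] openin_continuous_map_preimage[OF c2]
          s openin_Cantor_coordinate)
    moreover have "{p \<in> topspace ?P. (fst p, fst (snd p)) \<in> {z \<in> topspace (prod_topology X Y). s z k \<le> m}}
        \<inter> {p \<in> topspace ?P. snd (snd p) \<in> {b. b k}} =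
        {p \<in> topspace ?P. s (fst p, fst (snd p)) k \<le> m \<and> snd (snd p) k}" for k
      using E(1) unfolding top by auto
    ultimately show ?thesis unfolding W_def by (intro openin_Union) auto
  qed
  have "open_cover ?P (range (W n))" for n
    unfolding open_cover_def
  proof (intro conjI ballI antisym)
    show "openin ?P V" if "V \<in> range (W n)" for V using that W_open by auto
    then show "\<Union>(range (W n)) \<subseteq> topspace ?P" by (intro Union_least openin_subset)
    show "topspace ?P \<subseteq> \<Union>(range (W n))"
    proof
      fix p assume p: "p \<in> topspace ?P"
      obtain x y b where xyb: "p = (x, (y, b))" by (cases p) auto
      then have xy: "x \<in> topspace X" "(y, b) \<in> E" using p unfolding top by auto
      obtain k where "k \<ge> n" "b k" using E(2)[OF xy(2)] unfolding INFM_nat_le by auto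
      then have "p \<in> W n (s (x, y) k)" unfolding xyb W using xy by auto
      then show "p \<in> \<Union>(range (W n))" by auto
    qed
  qed
  \<comment> \<open>Catching a point at arbitrarily large \<open>n\<close> is essential, since
    \<open>dom\<close> gives its inequality only for almost all \<open>n\<close>.\<close>
  then obtain \<F> where \<F>: "\<And>n. finite (\<F> n)" "\<And>n. \<F> n \<subseteq> range (W n)"
    "\<And>p N. p \<in> topspace ?P \<Longrightarrow> \<exists>n\<ge>N. p \<in> \<Union>(\<F> n)"
    by (rule Menger_space_infinitely_often[of ?P "\<lambda>n. range (W n)", OF M]) (rule that; assumption)
  \<comment> \<open>\<open>W n m\<close> grows with \<open>m\<close>, so a finite selection is
    contained in a single \<open>W n (g n)\<close>.\<close>
  have "\<exists>g. \<Union>(\<F> n) \<subseteq> W n g" for n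
  proof -
    obtain A where A: "finite A" "\<F> n = W n ` A"
      using finite_subset_image[of "\<F> n" "W n" UNIV, OF \<F>(1,2)] by auto
    have "W n m \<subseteq> W n (\<Sum>A)" if "m \<in> A" for m
    proof -
      have "m \<le> \<Sum>A" using A(1) that by (intro member_le_sum) auto
      then show ?thesis unfolding W_def by (intro UN_mono) auto
    qed
    then show ?thesis using A(2) by (intro exI[of _ "\<Sum>A"]) auto
  qed
  then have "\<exists>g. \<forall>n. \<Union>(\<F> n) \<subseteq> W n (g n)" by (intro choice allI)
  then obtain g where g: "\<forall>n. \<Union>(\<F> n) \<subseteq> W n (g n)" ..
  obtain x y b where xyb: "x \<in> topspace X" "(y, b) \<in> E"
    "\<forall>\<^sub>F n in sequentially. \<forall>k. n \<le> k \<and> b k \<longrightarrow> g n < s (x, y) k"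
    using dom[of g] by (elim exE conjE)
  obtain N where N: "\<And>n k. N \<le> n \<Longrightarrow> n \<le> k \<Longrightarrow> b k \<Longrightarrow> g n < s (x, y) k"
    using xyb(3) unfolding eventually_sequentially by auto
  have "(x, (y, b)) \<in> topspace ?P" using xyb unfolding top by simp
  then obtain n where n: "N \<le> n" "(x, (y, b)) \<in> \<Union>(\<F> n)" using \<F>(3) by blast
  then have "(x, (y, b)) \<in> W n (g n)" using g by blast
  then obtain k where "k \<ge> n" "b k" "s (x, y) k \<le> g n" unfolding W by auto
  then show False using N[OF n(1)] by fastforce
qed

text \<open>All three claims reduce to this one, as each of their hypotheses makes
  \<open>X \<times> T\<close> Menger for every hereditarily Lindelof \<open>U\<close>-Menger
  \<open>T\<close>.\<close>

lemma productively_Hurewicz_if_Menger_products: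
  fixes X :: "'a topology"
  assumes bd: "\<bb> =o \<dd>" and X: "infinite_Tychonoff_space X"
    and prod: "\<And>U T. free_ultrafilter U \<Longrightarrow> hereditarily_Lindelof_Tychonoff T \<Longrightarrow>
      ultrafilter_Menger_space U T \<Longrightarrow> Menger_space (prod_topology X (T :: real topology))"
  shows "productively_Hurewicz_in (hereditarily_Lindelof_Tychonoff :: 'b topology \<Rightarrow> bool) X"
  unfolding productively_Hurewicz_in_def
proof (intro allI impI, elim conjE)
  fix Y :: "'b topology"
  assume Y: "hereditarily_Lindelof_Tychonoff Y" "Hurewicz_space Y"
  then have Yinf: "infinite (topspace Y)"
    by (simp add: hereditarily_Lindelof_Tychonoff_def infinite_Tychonoff_space_def)
  then have Yne: "topspace Y \<noteq> {}" by (rule infinite_imp_nonempty)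
  have Xne: "topspace X \<noteq> {}"
    using X by (intro infinite_imp_nonempty) (simp add: infinite_Tychonoff_space_def)
  let ?Z = "prod_topology X Y"
  have Zne: "topspace ?Z \<noteq> {}" using Xne Yne by (simp only: topspace_prod_topology) auto
  \<comment> \<open>Any free ultrafilter does here: the Hurewicz space \<open>Y\<close> is
    \<open>U0\<close>-Menger, so \<open>X \<times> Y\<close> is Menger and in particular Lindelof,
    as the cover functions require.\<close>
  obtain U0 where U0: "free_ultrafilter U0"
    using exists_free_ultrafilter_le[of sequentially] by auto
  have "Menger_space ?Z"
    by (rule Menger_product_transfer[OF prod[OF U0] Y(1) Hurewicz_imp_ultrafilter_Menger[OF Y(2) U0]])
  then have ZL: "Lindelof_space ?Z" by (rule Menger_imp_Lindelof)
  show "Hurewicz_space ?Z"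
  proof (rule ccontr)
    assume "\<not> Hurewicz_space ?Z"
    then obtain s :: "'a \<times> 'b \<Rightarrow> nat \<Rightarrow> nat" where s: "\<And>z. z \<in> topspace ?Z \<Longrightarrow> mono (s z)"
      "\<And>n m. openin ?Z {z \<in> topspace ?Z. s z n \<le> m}" "unbounded_family (s ` topspace ?Z)"
      by (rule Lindelof_not_Hurewicz[OF ZL _ Zne]) (rule that; assumption)
    obtain r :: "(nat \<Rightarrow> nat) rel" and p where r: "Well_order r"
      "\<And>i. i \<in> Field r \<Longrightarrow> |underS r i| <o \<bb>"
      "\<And>i. i \<in> Field r \<Longrightarrow> strict_mono (p i :: nat \<Rightarrow> nat)"
      "\<And>g. \<exists>j\<in>Field r. \<forall>i. (j, i) \<in> r \<longrightarrow> g \<le>\<^sup>* p i"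
      by (rule exists_scale[OF bd]) (rule that; assumption)
    have tot: "total_on (Field r) r" and rf: "refl_on (Field r) r"
      using r(1) by (auto simp: well_order_on_def linear_order_on_def partial_order_on_def
          preorder_on_def)
    \<comment> \<open>One application of \<open>p i\<close> accounts for the length of the runs in
      \<open>b i\<close>, the other for the height of \<open>s (z i)\<close> along them.\<close>
    let ?q = "\<lambda>i n. p i (p i n)"
    have q: "mono (?q i)" if "i \<in> Field r" for i
      using strict_mono_mono[OF r(3)[OF that]] by (simp add: mono_def)
    obtain z U where U: "free_ultrafilter U" and z: "\<And>i. i \<in> Field r \<Longrightarrow> z i \<in> topspace ?Z"
      and zU: "\<And>i. i \<in> Field r \<Longrightarrow> \<forall>\<^sub>F m in U. ?q i m \<le> s (z i) m"
      by (rule unbounded_modulo_ultrafilter[of r ?q "topspace ?Z" s, OF r(1,2) q s(1,3)])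
        (assumption | rule that; assumption)+
    define b where "b i n \<longleftrightarrow> p i n \<le> s (z i) n" for i n
    \<comment> \<open>A large value at \<open>m\<close> persists by monotonicity of
      \<open>s (z i)\<close>, while \<open>p i k\<close> stays below \<open>p i (p i m)\<close> as
      long as \<open>k \<le> p i m\<close>.\<close>
    have run: "b i k" if i: "i \<in> Field r" and m: "?q i m \<le> s (z i) m" "m \<le> k" "k \<le> p i m" for i m k
    proof -
      have "p i k \<le> ?q i m" using r(3)[OF i] m(3) by (simp add: strict_mono_less_eq)
      also have "\<dots> \<le> s (z i) k" using m(1) monoD[OF s(1)[OF z[OF i]] m(2)] by (rule order_trans)
      finally show ?thesis by (simp add: b_def)
    qed
    have b_inf: "\<exists>\<^sub>\<infinity>k. b i k" if i: "i \<in> Field r" for i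
    proof -
      have "infinite {m. ?q i m \<le> s (z i) m}"
        using U zU[OF i] by (simp add: free_ultrafilter_def)
      moreover have "{m. ?q i m \<le> s (z i) m} \<subseteq> {m. b i m}"
        using run[OF i] strict_mono_imp_increasing[OF r(3)[OF i]] by auto
      ultimately show ?thesis unfolding INFM_iff_infinite using infinite_super by blast
    qed
    define t where "t i = (snd (z i), b i)" for i
    define E where "E = {(y, c). y \<in> topspace Y \<and> (\<exists>n. \<forall>k\<ge>n. c k)} \<union> t ` Field r"
    have zY: "fst (z i) \<in> topspace X \<and> snd (z i) \<in> topspace Y" if "i \<in> Field r" for i
      using z[OF that] by (simp add: mem_Times_iff)
    have E_sub: "E \<subseteq> topspace Y \<times> UNIV"
      using zY unfolding E_def t_def by auto
    interpret cofinite_subspace Y E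
      by unfold_locales (use E_sub in \<open>auto simp: E_def\<close>)
    have "infinite ((\<lambda>y. (y, \<lambda>_. True)) ` topspace Y :: ('b \<times> (nat \<Rightarrow> bool)) set)"
      using Yinf by (subst finite_image_iff) (auto simp: inj_on_def)
    moreover have "(\<lambda>y. (y, \<lambda>_. True)) ` topspace Y \<subseteq> E"
      unfolding E_def by auto
    ultimately have "infinite E" using infinite_super by blast
    then have T: "hereditarily_Lindelof_Tychonoff T"
      using hereditarily_Lindelof_Tychonoff_subspace[OF Y(1) _ E_sub] by blast
    then have TL: "Lindelof_space T"
      unfolding hereditarily_Lindelof_Tychonoff_def by (auto simp: hereditarily_inc)
    have UM: "ultrafilter_Menger_space U T"
    proof (rule ultrafilter_Menger_concentrated[OF Y(2) Yne TL U])
      show "(\<exists>n. \<forall>k\<ge>n. c k) \<or> (\<exists>i\<in>Field r. t i = (v, c))" if "(v, c) \<in> E" for v c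
        using that unfolding E_def by auto
      show "t ` Field r \<subseteq> E" unfolding E_def by auto
      show "\<exists>K\<subseteq>Field r. |K| <o \<bb> \<and>
          (\<forall>i\<in>Field r - K. \<forall>\<^sub>F n in U. \<forall>k. n \<le> k \<and> k < g n \<longrightarrow> snd (t i) k)" for g
      proof -
        \<comment> \<open>Only the fewer than \<bb> indices before \<open>j\<close> are exceptional.
          From \<open>j\<close> on, \<open>g n \<le> p i n\<close> for \<open>U\<close>-many
          \<open>n\<close>, so the run of \<open>b i\<close> from \<open>n\<close> to
          \<open>p i n\<close> contains the interval up to \<open>g n - 1\<close>.\<close>
        obtain j where j: "j \<in> Field r" "\<And>i. (j, i) \<in> r \<Longrightarrow> g \<le>\<^sup>* p i"
          using r(4)[of g] by auto
        have "\<forall>\<^sub>F n in U. \<forall>k. n \<le> k \<and> k < g n \<longrightarrow> snd (t i) k" if i: "i \<in> Field r - underS r j" for i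
        proof -
          have "(j, i) \<in> r"
          proof (cases "i = j")
            case True
            then show ?thesis using refl_onD[OF rf j(1)] by simp
          next
            case False
            then show ?thesis using tot i j(1) unfolding total_on_def by (auto simp: underS_def)
          qed
          then have "\<forall>\<^sub>F n in sequentially. g n \<le> p i n"
            using j(2) by (simp add: eventually_dominated_def)
          then have "\<forall>\<^sub>F n in U. g n \<le> p i n"
            by (rule filter_leD[OF free_ultrafilter_le_sequentially[OF U]])
          moreover have "\<forall>\<^sub>F n in U. ?q i n \<le> s (z i) n" using zU i by simp
          ultimately show ?thesis
          proof (rule eventually_elim2)
            fix n assume n: "g n \<le> p i n" "?q i n \<le> s (z i) n"
            show "\<forall>k. n \<le> k \<and> k < g n \<longrightarrow> snd (t i) k"
              using run[of i n] i n by (auto simp: t_def)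
          qed
        qed
        moreover have "underS r j \<subseteq> Field r" by (auto simp: underS_def Field_def)
        ultimately show ?thesis using r(2)[OF j(1)] by blast
      qed
    qed
    have "Menger_space (prod_topology X T)"
      by (rule Menger_product_transfer[OF prod[OF U] T UM])
    moreover have "\<not> Menger_space (prod_topology X T)"
    proof (rule not_Menger_if_dominating[OF s(2) E_sub])
      show "\<exists>\<^sub>\<infinity>k. c k" if yc: "(y, c) \<in> E" for y c
      proof -
        consider n where "\<forall>k\<ge>n. c k" | i where "i \<in> Field r" "c = b i"
          using yc unfolding E_def t_def by auto
        then show ?thesis
        proof cases
          case 1
          then have "\<exists>k\<ge>m. c k" for m by (intro exI[of _ "max m n"]) simp
          then show ?thesis unfolding INFM_nat_le by blast
        qed (simp add: b_inf)
      qed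
      show "\<exists>x y c. x \<in> topspace X \<and> (y, c) \<in> E \<and>
        (\<forall>\<^sub>F n in sequentially. \<forall>k. n \<le> k \<and> c k \<longrightarrow> g n < s (x, y) k)" for g
      proof -
        \<comment> \<open>The successor secures the strict inequality \<open>g n < p i n\<close>; it
          passes to \<open>s (z i) k\<close> for all \<open>k \<ge> n\<close> in \<open>b i\<close>
          because \<open>p i\<close> is increasing.\<close>
        obtain i where i: "i \<in> Field r" "(\<lambda>n. Suc (g n)) \<le>\<^sup>* p i"
          using r(4)[of "\<lambda>n. Suc (g n)"] refl_onD[OF rf] by auto
        have "\<forall>\<^sub>F n in sequentially. \<forall>k. n \<le> k \<and> b i k \<longrightarrow> g n < s (z i) k"
          using i(2) unfolding eventually_dominated_def
        proof (rule eventually_mono)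
          fix n assume n: "Suc (g n) \<le> p i n"
          show "\<forall>k. n \<le> k \<and> b i k \<longrightarrow> g n < s (z i) k"
          proof (intro allI impI, elim conjE)
            fix k assume k: "n \<le> k" "b i k"
            have "g n < p i n" using n by simp
            also have "\<dots> \<le> p i k" using r(3)[OF i(1)] k(1) by (simp add: strict_mono_less_eq)
            also have "\<dots> \<le> s (z i) k" using k(2) by (simp add: b_def)
            finally show "g n < s (z i) k" .
          qed
        qed
        moreover have "(snd (z i), b i) \<in> E" using i(1) unfolding E_def t_def by auto
        ultimately show ?thesis using zY[OF i(1)]
          by (intro exI[of _ "fst (z i)"] exI[of _ "snd (z i)"] exI[of _ "b i"]) simp
      qed
    qed
    ultimately show False by contradiction
  qed
qed

theorem theorem4p1:
  assumes "\<bb> =o \<dd>"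
  shows
    "(\<forall>X :: 'a topology. infinite_Tychonoff_space X \<longrightarrow>
        (\<forall>U. free_ultrafilter U \<longrightarrow>
          (\<forall>T :: real topology.
             hereditarily_Lindelof_Tychonoff T \<and> ultrafilter_Menger_space U T \<longrightarrow>
             Menger_space (prod_topology X T))) \<longrightarrow>
        productively_Hurewicz_in (hereditarily_Lindelof_Tychonoff :: 'b topology \<Rightarrow> bool) X)
     \<and>
     (\<forall>X :: 'a topology. infinite_Tychonoff_space X \<longrightarrow>
        productively_Scheepers_in (hereditarily_Lindelof_Tychonoff :: real topology \<Rightarrow> bool) X \<longrightarrow>
        productively_Hurewicz_in (hereditarily_Lindelof_Tychonoff :: 'b topology \<Rightarrow> bool) X)
     \<and>
     (\<forall>X :: 'a topology. infinite_Tychonoff_space X \<longrightarrow>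
        (\<forall>U. free_ultrafilter U \<longrightarrow>
          productively_ultrafilter_Menger_in U
            (hereditarily_Lindelof_Tychonoff :: real topology \<Rightarrow> bool) X) \<longrightarrow>
        productively_Hurewicz_in (hereditarily_Lindelof_Tychonoff :: 'b topology \<Rightarrow> bool) X)"
proof (intro conjI allI impI)
  fix X :: "'a topology" assume X: "infinite_Tychonoff_space X"
  note reduce = productively_Hurewicz_if_Menger_products[OF assms X]
  show "productively_Hurewicz_in (hereditarily_Lindelof_Tychonoff :: 'b topology \<Rightarrow> bool) X"
    if "\<forall>U. free_ultrafilter U \<longrightarrow> (\<forall>T :: real topology.
             hereditarily_Lindelof_Tychonoff T \<and> ultrafilter_Menger_space U T \<longrightarrow>
             Menger_space (prod_topology X T))"
    using that by (intro reduce) simp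
  \<comment> \<open>A \<open>U\<close>-Menger \<open>T\<close> is Scheepers, hence so is
    \<open>X \<times> T\<close>, which is therefore Menger.\<close>
  show "productively_Hurewicz_in (hereditarily_Lindelof_Tychonoff :: 'b topology \<Rightarrow> bool) X"
    if "productively_Scheepers_in (hereditarily_Lindelof_Tychonoff :: real topology \<Rightarrow> bool) X"
    using that unfolding productively_Scheepers_in_def
    by (intro reduce Scheepers_imp_Menger) (simp add: ultrafilter_Menger_imp_Scheepers)
  show "productively_Hurewicz_in (hereditarily_Lindelof_Tychonoff :: 'b topology \<Rightarrow> bool) X"
    if "\<forall>U. free_ultrafilter U \<longrightarrow> productively_ultrafilter_Menger_in U
            (hereditarily_Lindelof_Tychonoff :: real topology \<Rightarrow> bool) X"
  proof (rule reduce)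
    fix U and T :: "real topology"
    assume U: "free_ultrafilter U" and T: "hereditarily_Lindelof_Tychonoff T" "ultrafilter_Menger_space U T"
    \<comment> \<open>Here the product is even \<open>U\<close>-Menger, from which Menger follows by
      way of Scheepers.\<close>
    then have "ultrafilter_Menger_space U (prod_topology X T)"
      using that unfolding productively_ultrafilter_Menger_in_def by simp
    then show "Menger_space (prod_topology X T)"
      using U by (intro Scheepers_imp_Menger ultrafilter_Menger_imp_Scheepers)
  qed
qed

end
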